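(* Let $H$ be the Gårding–Wightman module associated to a triple $(\mu,\nu,\{c_k\})$. Then $H$ admits an invariant real form if and only if the following three conditions hold: $\mu$ and $\tilde\mu$ are equivalent (mutually absolutely continuous); $\nu(x)=\nu(\mathbf 1-x)$ for almost all $x\in X$; and there exists a measurable family of operators $r(x): H_x\to H_{\mathbf 1-x}= H_x$ which are antilinear, preserve the norm and satisfy $$r(x)\,r(\mathbf 1-x)=1,\qquad r(x)\,c_k(\mathbf 1-x)=(-1)^k c_k(x)\,r(x+\delta_k)$$ for all indices $k$ and almost all $x\in X$.
   Context: $Z$ is a real separable Hilbert space (of even finite dimension $2m$, or infinite-dimensional), and $C(Z)$ is its Clifford algebra: the quotient of the real tensor algebra of $Z$ by the ideal generated by the elements $zw+wz+2(z,w)1$, $z,w\in Z$; $C_{\mathbb C}(Z)=\mathbb C\otimes C(Z)$. Fix an orthogonal complex structure $\sigma$ on $Z$ and a unitary basis $z_1,z_2,\dots$ of $(Z,\sigma)$, so that $\{z_k,\sigma(z_k)\}_k$ is a real orthonormal basis of $Z$. The index $k$ ranges over $\{1,\dots,m\}$ if $\dim Z=2m$ and over $\mathbb N=\{1,2,\dots\}$ if $\dim Z=\infty$. $X$ is the set of sequences $x=(x_k)_k$ with $x_k\in\{0,1\}$, a group under componentwise addition mod 2; $\delta_k\in X$ has $k$-th entry $1$ and all others $0$; $\Delta\subset X$ is the subgroup of sequences with finitely many $1$'s; $\mathbf 1=(1,1,\dots)$, so $\mathbf 1-x=(1-x_1,1-x_2,\dots)$. $X$ carries the $\sigma$-algebra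 generated by the sets $X_k=\{x: x_k=1\}$. A Gårding–Wightman (GW) triple $(\mu,\nu,\{c_k\})$ consists of: (a) a nonzero $\sigma$-finite positive measure $\mu$ on $X$, quasi-invariant under $\Delta$: for each $\delta\in\Delta$ the measure $\mu_\delta(E)=\mu(E+\delta)$ has the same null sets as $\mu$; write $\frac{d\mu(x+\delta)}{d\mu(x)}$ for the Radon–Nikodym derivative $\frac{d\mu_\delta}{d\mu}(x)$; (b) a measurable function $\nu:X\to\{1,2,\dots\}\cup\{\infty\}$ with $\nu(x+\delta)=\nu(x)$ for all $\delta\in\Delta$ and almost all $x$; (c) fixing for each $n$ a separable complex Hilbert space $\mathcal H_n$ of dimension $n$ and setting $H_x=\mathcal H_{\nu(x)}$ (so $H_{x+\delta}=H_x$ for $\delta\in\Delta$ and a.e. $x$, and $H_{\mathbf 1-x}=H_x$ whenever $\nu(\mathbf 1-x)=\nu(x)$), unitary operators $c_k(x):H_x\to H_{x+\delta_k}=H_x$, depending measurably on $x$, with $c_k(x)^*=c_k(x+\delta_k)$ and $c_k(x)c_l(x+\delta_k)=c_l(x)c_k(x+\delta_l)$ for all $k,l$ and almost all $x$. The associated GW module is the Hilbert space $H=\int_X^{\oplus}H_x\,d\mu(x)$ (elements: square-integrable measurable fields $f(x)\in H_x$) with the continuous representation $\mathbb J$ of $C_{\mathbb C}(Z)$, where $Z$ acts by skew-hermitian operators $\mathbb J_z$ (real linear in $z$), determined by $$(\mathbb J_{z_k}f)(x)=(-1)^{x_1+\dots+x_{k-1}+1}\,i\,c_k(x)\sqrt{\tfrac{d\mu(x+\delta_k)}{d\mu(x)}}\,f(x+\delta_k),\qquad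 (\mathbb J_{\sigma(z_k)}f)(x)=(-1)^{x_k}\,i\,(\mathbb J_{z_k}f)(x).$$ An invariant real structure on $H$ is an antilinear operator $S:H\to H$ with $S^2=1$, $\|Sf\|=\|f\|$ for all $f$, and $S\mathbb J_z=\mathbb J_zS$ for all $z\in Z$; an invariant real form of $H$ is the real subspace $\{f\in H: Sf=f\}$ of fixed points of such an $S$. $\tilde\mu$ is the measure $\tilde\mu(E)=\mu(\mathbf 1-E)$, where $\mathbf 1-E=\{\mathbf 1-x: x\in E\}$. *)

theory Defs
  imports
    "HOL-Analysis.Analysis"
    "HOL-Library.Z2"
    "HOL-Library.Function_Algebras"
begin

text \<open>A complex Hilbert space, linear in the first argument of the inner product; the underlying
  real Hilbert space supplies norm, topology and completeness.\<close>

class complex_hilbert = real_inner + complete_space +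
  fixes scaleC :: "complex \<Rightarrow> 'a \<Rightarrow> 'a" (infixr "*\<^sub>C" 75)
    and cinner :: "'a \<Rightarrow> 'a \<Rightarrow> complex"
  assumes scaleC_add_right: "a *\<^sub>C (v + w) = a *\<^sub>C v + a *\<^sub>C w"
    and scaleC_add_left: "(a + b) *\<^sub>C v = a *\<^sub>C v + b *\<^sub>C v"
    and scaleC_scaleC: "a *\<^sub>C (b *\<^sub>C v) = (a * b) *\<^sub>C v"
    and scaleC_of_real: "complex_of_real t *\<^sub>C v = t *\<^sub>R v"
    and cinner_commute: "cinner v w = cnj (cinner w v)"
    and cinner_add_left: "cinner (u + v) w = cinner u w + cinner v w"
    and cinner_scaleC_left: "cinner (a *\<^sub>C v) w = a * cinner v w"
    and inner_eq_Re_cinner: "inner v w = Re (cinner v w)"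

definition csubspace :: "'v::complex_hilbert set \<Rightarrow> bool" where
  "csubspace V \<longleftrightarrow> 0 \<in> V \<and> (\<forall>v\<in>V. \<forall>w\<in>V. v + w \<in> V) \<and> (\<forall>a. \<forall>v\<in>V. a *\<^sub>C v \<in> V)"

definition cspan :: "'v::complex_hilbert set \<Rightarrow> 'v set" where
  "cspan B = \<Inter>{V. csubspace V \<and> B \<subseteq> V}"

text \<open>\<open>V\<close> is a (closed) Hilbert subspace with an orthonormal basis of \<open>n\<close> elements,
  \<open>n = \<infinity>\<close> meaning countably infinite.\<close>

definition has_hilbert_dim :: "'v::complex_hilbert set \<Rightarrow> enat \<Rightarrow> bool" where
  "has_hilbert_dim V n \<longleftrightarrow> (\<exists>e :: nat \<Rightarrow> 'v.
     (\<forall>i j. enat i < n \<and> enat j < n \<longrightarrow> cinner (e i) (e j) = (if i = j then 1 else 0)) \<and>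
     V = closure (cspan (e ` {j. enat j < n})))"

text \<open>In the following, an operator between subspaces \<open>V\<close> and \<open>W\<close> is a total function of which
  only the values on \<open>V\<close> matter.\<close>

definition unitary_between :: "'v::complex_hilbert set \<Rightarrow> 'v set \<Rightarrow> ('v \<Rightarrow> 'v) \<Rightarrow> bool" where
  "unitary_between V W T \<longleftrightarrow> T ` V = W \<and>
     (\<forall>a b. \<forall>v\<in>V. \<forall>w\<in>V. T (a *\<^sub>C v + b *\<^sub>C w) = a *\<^sub>C T v + b *\<^sub>C T w) \<and>
     (\<forall>v\<in>V. \<forall>w\<in>V. cinner (T v) (T w) = cinner v w)"

definition adjoint_between ::
  "'v::complex_hilbert set \<Rightarrow> 'v set \<Rightarrow> ('v \<Rightarrow> 'v) \<Rightarrow> ('v \<Rightarrow> 'v) \<Rightarrow> bool" where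
  "adjoint_between V W T T' \<longleftrightarrow> T' ` W \<subseteq> V \<and>
     (\<forall>v\<in>V. \<forall>w\<in>W. cinner (T v) w = cinner v (T' w))"

definition antilinear_isometry_between ::
  "'v::complex_hilbert set \<Rightarrow> 'v set \<Rightarrow> ('v \<Rightarrow> 'v) \<Rightarrow> bool" where
  "antilinear_isometry_between V W T \<longleftrightarrow> T ` V \<subseteq> W \<and>
     (\<forall>a b. \<forall>v\<in>V. \<forall>w\<in>V. T (a *\<^sub>C v + b *\<^sub>C w) = cnj a *\<^sub>C T v + cnj b *\<^sub>C T w) \<and>
     (\<forall>v\<in>V. norm (T v) = norm v)"

definition index_set :: "nat set \<Rightarrow> bool" where
  "index_set I \<longleftrightarrow> (\<exists>m. I = {1..m}) \<or> I = {1..}"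

definition orthogonal_complex_structure :: "('z::real_inner \<Rightarrow> 'z) \<Rightarrow> bool" where
  "orthogonal_complex_structure \<sigma> \<longleftrightarrow>
     linear \<sigma> \<and> (\<forall>z. \<sigma> (\<sigma> z) = - z) \<and> (\<forall>z w. inner (\<sigma> z) (\<sigma> w) = inner z w)"

text \<open>The family \<open>z\<^sub>k, \<sigma> z\<^sub>k\<close> (\<open>k \<in> I\<close>) is a real orthonormal basis. In particular the space has
  dimension \<open>2m\<close> if \<open>I = {1..m}\<close> and is infinite-dimensional if \<open>I = {1..}\<close>.\<close>

definition unitary_basis :: "nat set \<Rightarrow> ('z::real_inner \<Rightarrow> 'z) \<Rightarrow> (nat \<Rightarrow> 'z) \<Rightarrow> bool" where
  "unitary_basis I \<sigma> z \<longleftrightarrow>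
     (\<forall>k\<in>I. \<forall>l\<in>I. inner (z k) (z l) = (if k = l then 1 else 0) \<and>
        inner (\<sigma> (z k)) (\<sigma> (z l)) = (if k = l then 1 else 0) \<and> inner (z k) (\<sigma> (z l)) = 0) \<and>
     closure (span (z ` I \<union> (\<lambda>k. \<sigma> (z k)) ` I)) = UNIV"

text \<open>Sequences indexed by \<open>I\<close> are extended by \<open>0\<close>; type \<open>bit\<close> is the two-element field, so \<open>+\<close>
  on functions is the componentwise addition mod 2.\<close>

definition bitseqs :: "nat set \<Rightarrow> (nat \<Rightarrow> bit) set" where
  "bitseqs I = {x. \<forall>k. k \<notin> I \<longrightarrow> x k = 0}"

definition delta :: "nat \<Rightarrow> nat \<Rightarrow> bit" where
  "delta k = (\<lambda>j. if j = k then 1 else 0)"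

definition finite_bitseqs :: "nat set \<Rightarrow> (nat \<Rightarrow> bit) set" where
  "finite_bitseqs I = {d \<in> bitseqs I. finite {k. d k = 1}}"

definition ones :: "nat set \<Rightarrow> nat \<Rightarrow> bit" where
  "ones I = (\<lambda>k. if k \<in> I then 1 else 0)"

definition bitseq_space :: "nat set \<Rightarrow> (nat \<Rightarrow> bit) measure" where
  "bitseq_space I = sigma (bitseqs I) ((\<lambda>k. {x \<in> bitseqs I. x k = 1}) ` I)"

text \<open>Translation by \<open>d\<close> and \<open>x \<mapsto> \<one> - x\<close> are involutions, so the image measures below are
  \<open>E \<mapsto> \<mu>(E + d)\<close> and \<open>E \<mapsto> \<mu>(\<one> - E)\<close>.\<close>

definition translate :: "(nat \<Rightarrow> bit) \<Rightarrow> (nat \<Rightarrow> bit) measure \<Rightarrow> (nat \<Rightarrow> bit) measure" where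
  "translate d M = distr M M (\<lambda>x. x + d)"

definition reflect :: "nat set \<Rightarrow> (nat \<Rightarrow> bit) measure \<Rightarrow> (nat \<Rightarrow> bit) measure" where
  "reflect I M = distr M M (\<lambda>x. ones I - x)"

definition equivalent_measures :: "'a measure \<Rightarrow> 'a measure \<Rightarrow> bool" where
  "equivalent_measures M N \<longleftrightarrow>
     sets M = sets N \<and> absolutely_continuous M N \<and> absolutely_continuous N M"

definition translate_deriv :: "(nat \<Rightarrow> bit) measure \<Rightarrow> (nat \<Rightarrow> bit) \<Rightarrow> (nat \<Rightarrow> bit) \<Rightarrow> real" where
  "translate_deriv M d x = enn2real (RN_deriv M (translate d M) x)"

text \<open>\<open>\<H> n\<close> is the fixed Hilbert space of dimension \<open>n\<close>; the fibre over \<open>x\<close> is \<open>\<H> (\<nu> x)\<close>. All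
  \<open>\<H> n\<close> sit in one separable Hilbert space (their direct sum, for instance), which has to be
  second countable for Borel measurability to be well behaved.\<close>

definition measurable_fields ::
  "(enat \<Rightarrow> 'v::{complex_hilbert, second_countable_topology} set) \<Rightarrow> 'x measure \<Rightarrow> ('x \<Rightarrow> enat)
     \<Rightarrow> ('x \<Rightarrow> 'v) set" where
  "measurable_fields \<H> M \<nu> = {f \<in> borel_measurable M. \<forall>x\<in>space M. f x \<in> \<H> (\<nu> x)}"

definition measurable_operator_field ::
  "(enat \<Rightarrow> 'v::{complex_hilbert, second_countable_topology} set) \<Rightarrow> 'x measure \<Rightarrow> ('x \<Rightarrow> enat)
     \<Rightarrow> ('x \<Rightarrow> 'v \<Rightarrow> 'v) \<Rightarrow> bool" where
  "measurable_operator_field \<H> M \<nu> T \<longleftrightarrow>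
     (\<forall>f \<in> measurable_fields \<H> M \<nu>. (\<lambda>x. T x (f x)) \<in> borel_measurable M)"

definition GW_triple ::
  "nat set \<Rightarrow> (enat \<Rightarrow> 'v::{complex_hilbert, second_countable_topology} set)
     \<Rightarrow> (nat \<Rightarrow> bit) measure \<Rightarrow> ((nat \<Rightarrow> bit) \<Rightarrow> enat) \<Rightarrow> (nat \<Rightarrow> (nat \<Rightarrow> bit) \<Rightarrow> 'v \<Rightarrow> 'v) \<Rightarrow> bool"
  where
  "GW_triple I \<H> M \<nu> c \<longleftrightarrow>
     sets M = sets (bitseq_space I) \<and> sigma_finite_measure M \<and> emeasure M (space M) \<noteq> 0 \<and>
     (\<forall>d \<in> finite_bitseqs I. equivalent_measures (translate d M) M) \<and>
     \<nu> \<in> measurable M (count_space UNIV) \<and> (\<forall>x \<in> space M. 1 \<le> \<nu> x) \<and>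
     (\<forall>d \<in> finite_bitseqs I. AE x in M. \<nu> (x + d) = \<nu> x) \<and>
     (\<forall>k\<in>I. measurable_operator_field \<H> M \<nu> (c k) \<and>
        (AE x in M. unitary_between (\<H> (\<nu> x)) (\<H> (\<nu> (x + delta k))) (c k x)) \<and>
        (AE x in M. adjoint_between (\<H> (\<nu> x)) (\<H> (\<nu> (x + delta k))) (c k x) (c k (x + delta k)))) \<and>
     (\<forall>k\<in>I. \<forall>l\<in>I. AE x in M. \<forall>v \<in> \<H> (\<nu> x).
        c k x (c l (x + delta k) v) = c l x (c k (x + delta l) v))"

text \<open>A complex Hilbert space given by a carrier set and operations (needed for direct integrals,
  which depend on the measure and so cannot be types).\<close>

record 'h hilbert =
  carrier :: "'h set"
  hadd :: "'h \<Rightarrow> 'h \<Rightarrow> 'h"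
  hscale :: "complex \<Rightarrow> 'h \<Rightarrow> 'h"
  hinner :: "'h \<Rightarrow> 'h \<Rightarrow> complex"

definition hnorm :: "'h hilbert \<Rightarrow> 'h \<Rightarrow> real" where
  "hnorm H F = sqrt (Re (hinner H F F))"

text \<open>By the universal property of the quotient defining the Clifford algebra, a representation of
  it is a real linear map \<open>z \<mapsto> J z\<close> into the complex linear operators with
  \<open>J z J w + J w J z = -2 (z, w)\<close>.\<close>

definition clifford_module ::
  "'h hilbert \<Rightarrow> ('z::real_inner \<Rightarrow> 'h \<Rightarrow> 'h) \<Rightarrow> bool" where
  "clifford_module H J \<longleftrightarrow>
     (\<forall>z. \<forall>F\<in>carrier H. J z F \<in> carrier H) \<and>
     (\<forall>z a b. \<forall>F\<in>carrier H. \<forall>G\<in>carrier H.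
        J z (hadd H (hscale H a F) (hscale H b G)) =
          hadd H (hscale H a (J z F)) (hscale H b (J z G))) \<and>
     (\<forall>s t z w. \<forall>F\<in>carrier H.
        J (s *\<^sub>R z + t *\<^sub>R w) F =
          hadd H (hscale H (complex_of_real s) (J z F)) (hscale H (complex_of_real t) (J w F))) \<and>
     (\<forall>z w. \<forall>F\<in>carrier H.
        hadd H (J z (J w F)) (J w (J z F)) = hscale H (complex_of_real (- 2 * inner z w)) F) \<and>
     (\<forall>z. \<forall>F\<in>carrier H. \<forall>G\<in>carrier H. hinner H (J z F) G = - hinner H F (J z G)) \<and>
     (\<exists>C. \<forall>z. \<forall>F\<in>carrier H. hnorm H (J z F) \<le> C * norm z * hnorm H F)"

definition invariant_real_structure ::
  "'h hilbert \<Rightarrow> ('z \<Rightarrow> 'h \<Rightarrow> 'h) \<Rightarrow> ('h \<Rightarrow> 'h) \<Rightarrow> bool" where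
  "invariant_real_structure H J S \<longleftrightarrow>
     (\<forall>F\<in>carrier H. S F \<in> carrier H \<and> S (S F) = F \<and> hnorm H (S F) = hnorm H F) \<and>
     (\<forall>a b. \<forall>F\<in>carrier H. \<forall>G\<in>carrier H.
        S (hadd H (hscale H a F) (hscale H b G)) =
          hadd H (hscale H (cnj a) (S F)) (hscale H (cnj b) (S G))) \<and>
     (\<forall>z. \<forall>F\<in>carrier H. S (J z F) = J z (S F))"

definition invariant_real_form ::
  "'h hilbert \<Rightarrow> ('z \<Rightarrow> 'h \<Rightarrow> 'h) \<Rightarrow> 'h set \<Rightarrow> bool" where
  "invariant_real_form H J R \<longleftrightarrow>
     (\<exists>S. invariant_real_structure H J S \<and> R = {F \<in> carrier H. S F = F})"

definition L2_fields ::
  "(enat \<Rightarrow> 'v::{complex_hilbert, second_countable_topology} set) \<Rightarrow> 'x measure \<Rightarrow> ('x \<Rightarrow> enat)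
     \<Rightarrow> ('x \<Rightarrow> 'v) set" where
  "L2_fields \<H> M \<nu> = {f \<in> measurable_fields \<H> M \<nu>. integrable M (\<lambda>x. (norm (f x))\<^sup>2)}"

definition ae_class ::
  "(enat \<Rightarrow> 'v::{complex_hilbert, second_countable_topology} set) \<Rightarrow> 'x measure \<Rightarrow> ('x \<Rightarrow> enat)
     \<Rightarrow> ('x \<Rightarrow> 'v) \<Rightarrow> ('x \<Rightarrow> 'v) set" where
  "ae_class \<H> M \<nu> f = {g \<in> L2_fields \<H> M \<nu>. AE x in M. g x = f x}"

definition direct_integral ::
  "(enat \<Rightarrow> 'v::{complex_hilbert, second_countable_topology} set) \<Rightarrow> 'x measure \<Rightarrow> ('x \<Rightarrow> enat)
     \<Rightarrow> ('x \<Rightarrow> 'v) set hilbert" where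
  "direct_integral \<H> M \<nu> =
     (let rep = (\<lambda>F. SOME f. f \<in> F) in
      \<lparr> carrier = ae_class \<H> M \<nu> ` L2_fields \<H> M \<nu>,
        hadd = (\<lambda>F G. ae_class \<H> M \<nu> (\<lambda>x. rep F x + rep G x)),
        hscale = (\<lambda>a F. ae_class \<H> M \<nu> (\<lambda>x. a *\<^sub>C rep F x)),
        hinner = (\<lambda>F G. LINT x|M. cinner (rep F x) (rep G x)) \<rparr>)"

text \<open>\<open>J\<close> is the Clifford action of the GW module. The elements of the module are
  almost-everywhere classes, so the defining formulas are required of all representatives.\<close>

definition GW_action ::
  "nat set \<Rightarrow> ('z::real_inner \<Rightarrow> 'z) \<Rightarrow> (nat \<Rightarrow> 'z)
     \<Rightarrow> (enat \<Rightarrow> 'v::{complex_hilbert, second_countable_topology} set)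
     \<Rightarrow> (nat \<Rightarrow> bit) measure \<Rightarrow> ((nat \<Rightarrow> bit) \<Rightarrow> enat) \<Rightarrow> (nat \<Rightarrow> (nat \<Rightarrow> bit) \<Rightarrow> 'v \<Rightarrow> 'v)
     \<Rightarrow> ('z \<Rightarrow> ((nat \<Rightarrow> bit) \<Rightarrow> 'v) set \<Rightarrow> ((nat \<Rightarrow> bit) \<Rightarrow> 'v) set) \<Rightarrow> bool" where
  "GW_action I \<sigma> z \<H> M \<nu> c J \<longleftrightarrow>
     clifford_module (direct_integral \<H> M \<nu>) J \<and>
     (\<forall>k\<in>I. \<forall>F \<in> carrier (direct_integral \<H> M \<nu>).
        (\<forall>f\<in>F. \<forall>g \<in> J (z k) F. AE x in M.
           g x = ((- 1) ^ ((\<Sum>j\<in>{1..<k}. of_bool (x j = 1)) + 1) * \<i> *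
                  complex_of_real (sqrt (translate_deriv M (delta k) x))) *\<^sub>C
                 c k x (f (x + delta k))) \<and>
        (\<forall>g \<in> J (z k) F. \<forall>h \<in> J (\<sigma> (z k)) F. AE x in M.
           h x = ((- 1) ^ of_bool (x k = 1) * \<i>) *\<^sub>C g x))"

end

theory Submission imports Defs
begin

text \<open>
  Write \<open>x'\<close> for \<open>\<one> - x\<close> and \<open>\<rho>\<close> for the density of the reflected measure with respect to \<open>\<mu>\<close>. The
  invariant real structures of the module are exactly the operators
  \<open>(S f)(x) = \<surd>\<rho>(x) \<cdot> r(x) f(x')\<close>
  with \<open>r\<close> as in the statement.

  The algebraic core is \<open>commute_basis_iff\<close>: for an operator of this form, commutation with the
  action of \<open>z\<^sub>k\<close> at the point \<open>x\<close> is the relation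
  \<open>r(x) c\<^sub>k(x') = (-1)\<^sup>k c\<^sub>k(x) r(x + \<delta>\<^sub>k)\<close>. The positive scalars on the two sides agree by the chain
  rule for Radon--Nikodym derivatives (\<open>jac_cocycle\<close>), since reflection and translation commute.
  The sign collects the complex conjugation of \<open>\<i>\<close> and the change of the exponent
  \<open>x\<^sub>1 + \<dots> + x\<^sub>k\<^sub>-\<^sub>1\<close> into \<open>k - 1 - (x\<^sub>1 + \<dots> + x\<^sub>k\<^sub>-\<^sub>1)\<close>. Commutation with the action of \<open>\<sigma> z\<^sub>k\<close> then
  comes for free, and by linearity and boundedness commutation extends from the basis vectors to all
  of \<open>Z\<close> (\<open>commute_extend\<close>). Moreover \<open>S\<^sup>2 = 1\<close> is \<open>r(x) r(x') = 1\<close>, because \<open>\<rho>(x) \<rho>(x') = 1\<close>. This proves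
  sufficiency.

  For necessity, an invariant real structure \<open>S\<close> has to be decomposed. The product of the actions
  of \<open>\<sigma> z\<^sub>k\<close> and \<open>z\<^sub>k\<close> is multiplication by \<open>-\<i> (-1)\<close> to the power \<open>x\<^sub>k\<close>; as \<open>S\<close> commutes with the
  product and anticommutes with \<open>\<i>\<close>, it carries multiplication by the indicator of \<open>{x\<^sub>k = 1}\<close> to
  multiplication by the indicator of \<open>{x\<^sub>k = 0}\<close>. Hence \<open>S 1\<^sub>E = 1\<^sub>E\<^sub>' S\<close> for all measurable \<open>E\<close>, where
  \<open>E'\<close> is the reflection of \<open>E\<close> (\<open>s_indicator\<close>). This forces the
  reflected measure to be equivalent to \<open>\<mu>\<close>, and comparing norms over arbitrary sets gives
  \<open>\<parallel>(S f)(x)\<parallel>\<^sup>2 = \<rho>(x) \<parallel>f(x')\<parallel>\<^sup>2\<close> almost everywhere (\<open>norm_s\<close>), which polarises to inner products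
  (\<open>cinner_s\<close>). So \<open>S\<close> maps the fields formed by an orthonormal basis of the fibres to fields that,
  once normalised, are orthonormal at almost every \<open>x\<close>, with \<open>\<nu>(x')\<close> members in a space of
  dimension \<open>\<nu>(x)\<close>. Thus \<open>\<nu>(x') \<le> \<nu>(x)\<close>, and by symmetry equality holds. The operator
  \<open>r(x)\<close> is the antilinear extension of this correspondence of orthonormal systems, and a comparison
  of Fourier coefficients shows that it represents \<open>S\<close> (\<open>s_eq_fibre_op\<close>).
\<close>

section \<open>Complex Hilbert spaces and orthonormal systems\<close>

instance complex_hilbert \<subseteq> banach ..

lemma cinner_add_right: "cinner (u::'v::complex_hilbert) (v + w) = cinner u v + cinner u w"
  by (metis cinner_add_left cinner_commute complex_cnj_add)

lemma cinner_scaleC_right: "cinner (v::'v::complex_hilbert) (a *\<^sub>C w) = cnj a * cinner v w"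
  by (metis cinner_commute cinner_scaleC_left complex_cnj_mult)

lemma scaleC_one [simp]: "1 *\<^sub>C (v::'v::complex_hilbert) = v"
  using scaleC_of_real[of 1 v] by simp

lemma scaleC_zero_left [simp]: "0 *\<^sub>C (v::'v::complex_hilbert) = 0"
  using scaleC_of_real[of 0 v] by simp

lemma scaleC_minus_one: "(- 1) *\<^sub>C (v::'v::complex_hilbert) = - v"
  using scaleC_of_real[of "-1" v] by simp

lemma scaleC_zero_right [simp]: "a *\<^sub>C (0::'v::complex_hilbert) = 0"
  by (metis scaleC_scaleC scaleC_zero_left mult_zero_right)

lemma scaleC_minus_left: "(- a) *\<^sub>C (v::'v::complex_hilbert) = - (a *\<^sub>C v)"
  by (metis mult_minus1 scaleC_minus_one scaleC_scaleC)

lemma scaleC_minus_right: "a *\<^sub>C (- v) = - (a *\<^sub>C (v::'v::complex_hilbert))"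
  by (metis mult.commute scaleC_minus_one scaleC_scaleC)

lemma scaleC_sum_right: "a *\<^sub>C (\<Sum>i\<in>A. f i :: 'v::complex_hilbert) = (\<Sum>i\<in>A. a *\<^sub>C f i)"
  by (induction A rule: infinite_finite_induct) (auto simp: scaleC_add_right)

lemma scaleC_scaleR: "a *\<^sub>C (t *\<^sub>R (v::'v::complex_hilbert)) = t *\<^sub>R (a *\<^sub>C v)"
  by (metis mult.commute scaleC_of_real scaleC_scaleC)

lemma cinner_zero_left [simp]: "cinner 0 (v::'v::complex_hilbert) = 0"
  using cinner_scaleC_left[of 0 0 v] by simp

lemma cinner_zero_right [simp]: "cinner (v::'v::complex_hilbert) 0 = 0"
  using cinner_scaleC_right[of v 0 0] by simp

lemma cinner_scaleR_left: "cinner (t *\<^sub>R v) (w::'v::complex_hilbert) = t * cinner v w"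
  by (metis cinner_scaleC_left scaleC_of_real)

lemma cinner_scaleR_right: "cinner (v::'v::complex_hilbert) (t *\<^sub>R w) = t * cinner v w"
  by (metis cinner_scaleC_right scaleC_of_real complex_cnj_complex_of_real)

lemma cinner_sum_left: "cinner (\<Sum>i\<in>A. f i) (v::'v::complex_hilbert) = (\<Sum>i\<in>A. cinner (f i) v)"
  by (induction A rule: infinite_finite_induct) (auto simp: cinner_add_left)

lemma cinner_sum_right: "cinner (v::'v::complex_hilbert) (\<Sum>i\<in>A. f i) = (\<Sum>i\<in>A. cinner v (f i))"
  by (induction A rule: infinite_finite_induct) (auto simp: cinner_add_right)

lemma cinner_self: "cinner v (v::'v::complex_hilbert) = complex_of_real ((norm v)\<^sup>2)"
proof -
  have "Im (cinner v v) = 0"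
    using cinner_commute[of v v] by (metis complex_cnj_cancel_iff Reals_cnj_iff complex_is_Real_iff)
  then show ?thesis
    by (simp add: complex_eq_iff power2_norm_eq_inner inner_eq_Re_cinner)
qed

lemma norm_scaleC: "norm (a *\<^sub>C (v::'v::complex_hilbert)) = cmod a * norm v"
proof -
  have "complex_of_real ((norm (a *\<^sub>C v))\<^sup>2) = a * cnj a * complex_of_real ((norm v)\<^sup>2)"
    by (metis cinner_self cinner_scaleC_left cinner_scaleC_right mult.assoc)
  also have "\<dots> = complex_of_real ((cmod a * norm v)\<^sup>2)"
    by (metis complex_norm_square of_real_mult of_real_power power_mult_distrib)
  finally show ?thesis
    by (metis norm_ge_zero mult_nonneg_nonneg of_real_eq_iff power2_eq_imp_eq)
qed

lemma norm_cinner_le: "cmod (cinner v (w::'v::complex_hilbert)) \<le> norm v * norm w"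
proof (cases "cinner v w = 0")
  case False
  define u where "u = cnj (sgn (cinner v w))"
  have "complex_of_real (cmod (cinner v w)) = cinner (u *\<^sub>C v) w"
    using False by (simp add: u_def cinner_scaleC_left sgn_eq complex_norm_square[symmetric]
        power2_eq_square mult.commute[of "cnj _"])
  then have "cmod (cinner v w) = inner (u *\<^sub>C v) w"
    by (metis Re_complex_of_real inner_eq_Re_cinner)
  also have "\<dots> \<le> norm (u *\<^sub>C v) * norm w"
    by (rule norm_cauchy_schwarz)
  also have "norm (u *\<^sub>C v) = norm v"
    using False by (simp add: norm_scaleC u_def norm_sgn)
  finally show ?thesis .
qed simp

lemma bounded_bilinear_cinner: "bounded_bilinear (cinner :: 'v::complex_hilbert \<Rightarrow> 'v \<Rightarrow> complex)"
  by standard (auto simp: cinner_add_left cinner_add_right cinner_scaleR_left cinner_scaleR_right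
      scaleR_conv_of_real norm_cinner_le intro!: exI[of _ 1])

lemma bounded_bilinear_scaleC: "bounded_bilinear (scaleC :: complex \<Rightarrow> 'v::complex_hilbert \<Rightarrow> 'v)"
  by standard (auto simp: scaleC_add_left scaleC_add_right scaleC_scaleR norm_scaleC
      scaleR_conv_of_real scaleC_of_real scaleC_scaleC[symmetric] intro!: exI[of _ 1])

lemmas tendsto_scaleC [tendsto_intros] = bounded_bilinear.tendsto[OF bounded_bilinear_scaleC]
lemmas continuous_on_cinner [continuous_intros] =
  bounded_bilinear.continuous_on[OF bounded_bilinear_cinner]
lemmas continuous_on_scaleC [continuous_intros] =
  bounded_bilinear.continuous_on[OF bounded_bilinear_scaleC]

lemma borel_measurable_cinner [measurable (raw)]:
  fixes f g :: "'x \<Rightarrow> 'v::{complex_hilbert, second_countable_topology}"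
  assumes "f \<in> borel_measurable M" "g \<in> borel_measurable M"
  shows "(\<lambda>x. cinner (f x) (g x)) \<in> borel_measurable M"
  by (rule borel_measurable_continuous_Pair[OF assms]) (intro continuous_intros)

lemma borel_measurable_scaleC [measurable (raw)]:
  fixes f :: "'x \<Rightarrow> 'v::{complex_hilbert, second_countable_topology}"
  assumes "a \<in> borel_measurable M" "f \<in> borel_measurable M"
  shows "(\<lambda>x. a x *\<^sub>C f x) \<in> borel_measurable M"
  by (rule borel_measurable_continuous_Pair[OF assms]) (intro continuous_intros)

lemma norm_add_square:
  "(norm (v + w))\<^sup>2 = (norm v)\<^sup>2 + 2 * Re (cinner v w) + (norm (w::'v::complex_hilbert))\<^sup>2"
  by (simp add: power2_norm_eq_inner inner_simps inner_commute flip: inner_eq_Re_cinner)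

lemma norm_diff_square:
  "(norm (v - w))\<^sup>2 = (norm v)\<^sup>2 - 2 * Re (cinner v w) + (norm (w::'v::complex_hilbert))\<^sup>2"
  by (simp add: power2_norm_eq_inner inner_simps inner_commute flip: inner_eq_Re_cinner)

lemma norm_add_square_le: "(norm (v + w))\<^sup>2 \<le> 2 * (norm v)\<^sup>2 + 2 * (norm (w::'v::complex_hilbert))\<^sup>2"
proof -
  have "(norm (v + w))\<^sup>2 \<le> (norm v + norm w)\<^sup>2"
    by (intro power_mono norm_triangle_ineq) simp
  also have "\<dots> \<le> 2 * (norm v)\<^sup>2 + 2 * (norm w)\<^sup>2"
    using sum_squares_bound[of "norm v" "norm w"] by (simp add: power2_sum)
  finally show ?thesis .
qed

lemma csubspace_closed_spanI:
  fixes V :: "'v::complex_hilbert set"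
  assumes "csubspace V" "closed V" "B \<subseteq> V"
  shows "closure (cspan B) \<subseteq> V"
  using assms by (intro closure_minimal) (auto simp: cspan_def)

lemma csubspace_cspan: "csubspace (cspan B)"
  by (fastforce simp: cspan_def csubspace_def)

lemma cspan_superset: "B \<subseteq> cspan B"
  by (auto simp: cspan_def)

lemma csubspace_closure:
  fixes V :: "'v::complex_hilbert set"
  assumes "csubspace V"
  shows "csubspace (closure V)"
  unfolding csubspace_def
proof (intro conjI ballI allI)
  show "0 \<in> closure V" using assms closure_subset by (auto simp: csubspace_def)
next
  fix v w assume "v \<in> closure V" "w \<in> closure V"
  then obtain f g where "\<And>n. f n \<in> V" "f \<longlonglongrightarrow> v" "\<And>n. g n \<in> V" "g \<longlonglongrightarrow> w"
    by (auto simp: closure_sequential)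
  then show "v + w \<in> closure V"
    using assms unfolding closure_sequential csubspace_def
    by (intro exI[of _ "\<lambda>n. f n + g n"]) (auto intro: tendsto_add)
next
  fix a :: complex and v assume "v \<in> closure V"
  then obtain f where "\<And>n. f n \<in> V" "f \<longlonglongrightarrow> v"
    by (auto simp: closure_sequential)
  then show "a *\<^sub>C v \<in> closure V"
    using assms unfolding closure_sequential csubspace_def
    by (intro exI[of _ "\<lambda>n. a *\<^sub>C f n"]) (auto intro: tendsto_scaleC)
qed

text \<open>An orthonormal system indexed by \<open>A \<subseteq> \<nat>\<close>, padded with zero vectors outside \<open>A\<close>. The padding
  allows systems of different finite or infinite lengths to be treated as sequences.\<close>

definition orthonormal_on :: "nat set \<Rightarrow> (nat \<Rightarrow> 'v::complex_hilbert) \<Rightarrow> bool" where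
  "orthonormal_on A e \<longleftrightarrow> (\<forall>i j. cinner (e i) (e j) = of_bool (i = j \<and> i \<in> A))"

lemma orthonormal_on_zero: "orthonormal_on A e \<Longrightarrow> i \<notin> A \<Longrightarrow> e i = 0"
  using cinner_self[of "e i"] by (auto simp: orthonormal_on_def)

lemma orthonormal_on_norm: "orthonormal_on A e \<Longrightarrow> i \<in> A \<Longrightarrow> norm (e i) = 1"
  using cinner_self[of "e i"] norm_ge_zero[of "e i"]
  by (simp add: orthonormal_on_def power2_eq_1_iff flip: of_real_power)

lemma has_hilbert_dimE:
  fixes V :: "'v::complex_hilbert set"
  assumes "has_hilbert_dim V n"
  obtains e where "orthonormal_on {i. enat i < n} e" "V = closure (cspan (range e))"
proof -
  obtain e :: "nat \<Rightarrow> 'v" where e: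
    "\<And>i j. enat i < n \<Longrightarrow> enat j < n \<Longrightarrow> cinner (e i) (e j) = (if i = j then 1 else 0)"
    "V = closure (cspan (e ` {j. enat j < n}))"
    using assms by (auto simp: has_hilbert_dim_def)
  define e' where "e' i = (if enat i < n then e i else 0)" for i
  have "orthonormal_on {i. enat i < n} e'"
    by (auto simp: orthonormal_on_def e'_def e(1))
  moreover have "cspan (range e') = cspan (e ` {j. enat j < n})"
  proof -
    have "range e' \<subseteq> W \<longleftrightarrow> e ` {j. enat j < n} \<subseteq> W" if "csubspace W" for W
      using that by (auto simp: e'_def csubspace_def split: if_splits)
    then show ?thesis unfolding cspan_def by (intro arg_cong[where f=Inter]) auto
  qed
  ultimately show ?thesis using e(2) that by metis
qed

lemma norm_sum_orthonormal:
  assumes "orthonormal_on A e" "finite F"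
  shows "(norm (\<Sum>i\<in>F. a i *\<^sub>C e i))\<^sup>2 = (\<Sum>i\<in>F \<inter> A. (cmod (a i))\<^sup>2)"
proof -
  have "complex_of_real ((norm (\<Sum>i\<in>F. a i *\<^sub>C e i))\<^sup>2) =
      (\<Sum>i\<in>F. \<Sum>j\<in>F. a i * (cnj (a j) * of_bool (i = j \<and> i \<in> A)))"
    using assms(1) unfolding cinner_self[symmetric] cinner_sum_left
    by (simp add: cinner_sum_right cinner_scaleC_left cinner_scaleC_right orthonormal_on_def sum_distrib_left
        mult.left_commute)
  also have "\<dots> = (\<Sum>i\<in>F. if i \<in> A then a i * cnj (a i) else 0)"
  proof (rule sum.cong[OF refl])
    fix i assume "i \<in> F"
    have "(\<Sum>j\<in>F. a i * (cnj (a j) * of_bool (i = j \<and> i \<in> A))) =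
        (\<Sum>j\<in>F. if j = i then (if i \<in> A then a i * cnj (a i) else 0) else 0)"
      by (intro sum.cong) auto
    then show "(\<Sum>j\<in>F. a i * (cnj (a j) * of_bool (i = j \<and> i \<in> A))) =
        (if i \<in> A then a i * cnj (a i) else 0)"
      using \<open>i \<in> F\<close> assms(2) by simp
  qed
  also have "\<dots> = (\<Sum>i\<in>F \<inter> A. a i * cnj (a i))"
    using assms(2) by (simp add: sum.inter_restrict)
  also have "\<dots> = complex_of_real (\<Sum>i\<in>F \<inter> A. (cmod (a i))\<^sup>2)"
    by (simp add: complex_norm_square del: of_real_power)
  finally show ?thesis by (simp only: of_real_eq_iff)
qed

lemma bessel_inequality:
  assumes "orthonormal_on A e" "finite F"
  shows "(\<Sum>i\<in>F. (cmod (cinner v (e i)))\<^sup>2) \<le> (norm v)\<^sup>2"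
proof -
  define w where "w = (\<Sum>i\<in>F. cinner v (e i) *\<^sub>C e i)"
  define S where "S = (\<Sum>i\<in>F. (cmod (cinner v (e i)))\<^sup>2)"
  have "(\<Sum>i\<in>F \<inter> A. (cmod (cinner v (e i)))\<^sup>2) = S"
    unfolding S_def using assms(2) orthonormal_on_zero[OF assms(1)]
    by (intro sum.mono_neutral_left) auto
  then have w: "(norm w)\<^sup>2 = S"
    using norm_sum_orthonormal[OF assms] by (simp add: w_def)
  have "cinner v w = complex_of_real S"
    by (simp add: w_def S_def cinner_sum_right cinner_scaleC_right complex_norm_square mult.commute
        del: of_real_power)
  then have "(norm (v - w))\<^sup>2 = (norm v)\<^sup>2 - 2 * S + S"
    using norm_diff_square[of v w] w by simp
  then have "S \<le> (norm v)\<^sup>2"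
    using zero_le_power2[of "norm (v - w)"] by linarith
  then show ?thesis by (simp add: S_def)
qed

lemma orthonormal_finite_expansion:
  assumes e: "orthonormal_on {..<m} e" and v: "v \<in> closure (cspan (range e))"
  shows "v = (\<Sum>j<m. cinner v (e j) *\<^sub>C e j)"
proof -
  define P where "P v = (\<Sum>j<m. cinner v (e j) *\<^sub>C e j)" for v
  have "closure (cspan (range e)) \<subseteq> {v. P v = v}"
  proof (rule csubspace_closed_spanI)
    have "P 0 = 0" "P (v + w) = P v + P w" "P (a *\<^sub>C v) = a *\<^sub>C P v" for v w a
      by (simp_all add: P_def cinner_add_left scaleC_add_left sum.distrib cinner_scaleC_left
          scaleC_sum_right scaleC_scaleC)
    then show "csubspace {v. P v = v}" by (simp add: csubspace_def)
    show "closed {v. P v = v}" unfolding P_def by (intro closed_Collect_eq continuous_intros)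
    show "range e \<subseteq> {v. P v = v}"
    proof clarify
      fix i
      have "(\<Sum>j<m. cinner (e i) (e j) *\<^sub>C e j) = (\<Sum>j<m. if j = i then e i else 0)"
        using e by (intro sum.cong) (auto simp: orthonormal_on_def)
      also have "\<dots> = e i" using orthonormal_on_zero[OF e, of i] by simp
      finally show "P (e i) = e i" by (simp add: P_def)
    qed
  qed
  then show ?thesis using v by (auto simp: P_def)
qed

text \<open>A Hilbert space of dimension \<open>m\<close> contains no orthonormal system of more than \<open>m\<close> vectors:
  double counting of \<open>\<bar>(h\<^sub>i, e\<^sub>j)\<bar>\<^sup>2\<close>.\<close>

lemma orthonormal_dim_le:
  fixes e h :: "nat \<Rightarrow> 'v::complex_hilbert"
  assumes e: "orthonormal_on {i. enat i < m} e" and h: "orthonormal_on {i. enat i < n} h"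
    and sub: "\<And>i. h i \<in> closure (cspan (range e))"
  shows "n \<le> m"
proof (cases m)
  case (enat k)
  show ?thesis
  proof (rule ccontr)
    assume "\<not> n \<le> m"
    then have kn: "enat i < n" if "i \<le> k" for i
      using that enat by (cases n) auto
    have e': "orthonormal_on {..<k} e" using e by (simp add: enat lessThan_def)
    have one: "(\<Sum>j<k. (cmod (cinner (h i) (e j)))\<^sup>2) = 1" if "i \<le> k" for i
    proof -
      have "(norm (h i))\<^sup>2 = (\<Sum>j<k. (cmod (cinner (h i) (e j)))\<^sup>2)"
        using norm_sum_orthonormal[OF e', of "{..<k}" "\<lambda>j. cinner (h i) (e j)"]
        by (simp flip: orthonormal_finite_expansion[OF e' sub])
      then show ?thesis using orthonormal_on_norm[OF h] kn[OF that] by simp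
    qed
    have "real (Suc k) = (\<Sum>i\<le>k. \<Sum>j<k. (cmod (cinner (h i) (e j)))\<^sup>2)"
      by (simp add: one)
    also have "\<dots> = (\<Sum>j<k. \<Sum>i\<le>k. (cmod (cinner (h i) (e j)))\<^sup>2)"
      by (rule sum.swap)
    also have "\<dots> = (\<Sum>j<k. \<Sum>i\<le>k. (cmod (cinner (e j) (h i)))\<^sup>2)"
      by (intro sum.cong refl) (subst cinner_commute, simp)
    also have "\<dots> \<le> (\<Sum>j<k. 1)"
    proof (rule sum_mono)
      fix j assume "j \<in> {..<k}"
      then have "norm (e j) = 1" using orthonormal_on_norm[OF e'] by simp
      then show "(\<Sum>i\<le>k. (cmod (cinner (e j) (h i)))\<^sup>2) \<le> 1"
        using bessel_inequality[OF h, of "{..k}" "e j"] by simp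
    qed
    finally show False by simp
  qed
qed simp

text \<open>The antilinear operator that carries an orthonormal system \<open>e\<close> to an orthonormal system
  \<open>h\<close> and vanishes on the orthogonal complement of \<open>e\<close>.\<close>

definition antilinear_ext :: "(nat \<Rightarrow> 'v) \<Rightarrow> (nat \<Rightarrow> 'v) \<Rightarrow> 'v \<Rightarrow> 'v::complex_hilbert" where
  "antilinear_ext e h v = (\<Sum>i. cnj (cinner v (e i)) *\<^sub>C h i)"

context
  fixes A :: "nat set" and e h :: "nat \<Rightarrow> 'v::complex_hilbert"
  assumes e: "orthonormal_on A e" and h: "orthonormal_on A h"
begin

lemma antilinear_ext_summable: "summable (\<lambda>i. cnj (cinner v (e i)) *\<^sub>C h i)"
  unfolding summable_Cauchy
proof (intro allI impI)
  fix \<epsilon> :: real assume "\<epsilon> > 0"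
  have "summable (\<lambda>i. (cmod (cinner v (e i)))\<^sup>2)"
    using bessel_inequality[OF e, of "{..<_}" v]
    by (intro summableI_nonneg_bounded[where x="(norm v)\<^sup>2"]) auto
  then obtain N where N: "\<And>m n. m \<ge> N \<Longrightarrow> norm (\<Sum>i=m..<n. (cmod (cinner v (e i)))\<^sup>2) < \<epsilon>\<^sup>2"
    using \<open>\<epsilon> > 0\<close> unfolding summable_Cauchy by (metis zero_less_power)
  have "norm (\<Sum>i=m..<n. cnj (cinner v (e i)) *\<^sub>C h i) < \<epsilon>" if "m \<ge> N" for m n
  proof -
    have "(norm (\<Sum>i=m..<n. cnj (cinner v (e i)) *\<^sub>C h i))\<^sup>2
        = (\<Sum>i\<in>{m..<n} \<inter> A. (cmod (cinner v (e i)))\<^sup>2)"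
      by (simp add: norm_sum_orthonormal[OF h])
    also have "\<dots> \<le> (\<Sum>i=m..<n. (cmod (cinner v (e i)))\<^sup>2)"
      by (intro sum_mono2) auto
    also have "\<dots> < \<epsilon>\<^sup>2" using N[OF that, of n] by simp
    finally show ?thesis using \<open>\<epsilon> > 0\<close> by (metis less_eq_real_def power_less_imp_less_base)
  qed
  then show "\<exists>N. \<forall>m\<ge>N. \<forall>n. norm (\<Sum>i=m..<n. cnj (cinner v (e i)) *\<^sub>C h i) < \<epsilon>" by blast
qed

lemma antilinear_ext_antilinear:
  "antilinear_ext e h (a *\<^sub>C v + b *\<^sub>C w) =
    cnj a *\<^sub>C antilinear_ext e h v + cnj b *\<^sub>C antilinear_ext e h w"
proof -
  have "(\<lambda>i. cnj a *\<^sub>C (cnj (cinner v (e i)) *\<^sub>C h i) + cnj b *\<^sub>C (cnj (cinner w (e i)) *\<^sub>C h i))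
      sums (cnj a *\<^sub>C antilinear_ext e h v + cnj b *\<^sub>C antilinear_ext e h w)"
    unfolding antilinear_ext_def
    by (intro sums_add bounded_linear.sums[OF bounded_bilinear.bounded_linear_right[OF
              bounded_bilinear_scaleC]] summable_sums antilinear_ext_summable)
  then show ?thesis
    unfolding antilinear_ext_def[of e h "a *\<^sub>C v + b *\<^sub>C w"]
    by (intro sums_unique[symmetric])
       (simp add: cinner_add_left cinner_scaleC_left scaleC_add_left scaleC_scaleC)
qed

lemma cinner_antilinear_ext: "cinner (h i) (antilinear_ext e h v) = cinner v (e i)"
proof -
  have "(\<lambda>j. cinner (h i) (cnj (cinner v (e j)) *\<^sub>C h j)) sums cinner (h i) (antilinear_ext e h v)"
    unfolding antilinear_ext_def
    by (intro bounded_linear.sums[OF bounded_bilinear.bounded_linear_right[OF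
              bounded_bilinear_cinner]] summable_sums antilinear_ext_summable)
  moreover have "cinner (h i) (cnj (cinner v (e j)) *\<^sub>C h j) = (if j = i then cinner v (e j) else 0)"
    for j
    using h orthonormal_on_zero[OF e, of i]
    by (auto simp: cinner_scaleC_right orthonormal_on_def)
  ultimately have "(\<lambda>j. if j = i then cinner v (e j) else 0) sums cinner (h i) (antilinear_ext e h v)"
    by simp
  from sums_unique2[OF this sums_single[of i "\<lambda>j. cinner v (e j)"]] show ?thesis .
qed

lemma antilinear_ext_basis: "antilinear_ext e h (e i) = h i"
proof -
  have "cnj (cinner (e i) (e j)) *\<^sub>C h j = (if j = i then h j else 0)" for j
    using e orthonormal_on_zero[OF h, of i] by (auto simp: orthonormal_on_def)
  then show ?thesis
    unfolding antilinear_ext_def using sums_unique[OF sums_single[of i h]] by simp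
qed

lemma norm_antilinear_ext_le: "norm (antilinear_ext e h v) \<le> norm v"
proof -
  have "(\<lambda>n. norm (\<Sum>i<n. cnj (cinner v (e i)) *\<^sub>C h i)) \<longlonglongrightarrow> norm (antilinear_ext e h v)"
    unfolding antilinear_ext_def
    by (intro tendsto_norm summable_LIMSEQ antilinear_ext_summable)
  moreover have "norm (\<Sum>i<n. cnj (cinner v (e i)) *\<^sub>C h i) \<le> norm v" for n
  proof -
    have "(norm (\<Sum>i<n. cnj (cinner v (e i)) *\<^sub>C h i))\<^sup>2
        = (\<Sum>i\<in>{..<n} \<inter> A. (cmod (cinner v (e i)))\<^sup>2)"
      by (simp add: norm_sum_orthonormal[OF h])
    also have "\<dots> \<le> (norm v)\<^sup>2" by (rule bessel_inequality[OF e]) simp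
    finally show ?thesis using norm_ge_zero power2_le_imp_le by blast
  qed
  ultimately show ?thesis by (intro LIMSEQ_le_const2) auto
qed

lemma continuous_on_antilinear_ext: "continuous_on X (antilinear_ext e h)"
proof (rule continuous_on_subset[OF linear_continuous_on])
  show "bounded_linear (antilinear_ext e h)"
  proof
    fix v w and t :: real
    show "antilinear_ext e h (v + w) = antilinear_ext e h v + antilinear_ext e h w"
      using antilinear_ext_antilinear[of 1 v 1 w] by simp
    show "antilinear_ext e h (t *\<^sub>R v) = t *\<^sub>R antilinear_ext e h v"
      using antilinear_ext_antilinear[of t v 0 v] by (simp add: scaleC_of_real)
    show "\<exists>K. \<forall>v. norm (antilinear_ext e h v) \<le> norm v * K"
      using norm_antilinear_ext_le by (intro exI[of _ 1]) auto
  qed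
qed auto

lemma antilinear_ext_mem: "antilinear_ext e h v \<in> closure (cspan (range h))"
  unfolding antilinear_ext_def
proof (rule closed_sequentially[OF closed_closure])
  show "(\<lambda>n. \<Sum>i<n. cnj (cinner v (e i)) *\<^sub>C h i) \<longlonglongrightarrow> (\<Sum>i. cnj (cinner v (e i)) *\<^sub>C h i)"
    by (intro summable_LIMSEQ antilinear_ext_summable)
  fix n
  have "(\<Sum>i<n. cnj (cinner v (e i)) *\<^sub>C h i) \<in> cspan (range h)"
    using csubspace_cspan[of "range h"] cspan_superset[of "range h"]
    by (induction n) (auto simp: csubspace_def image_subset_iff)
  then show "(\<Sum>i<n. cnj (cinner v (e i)) *\<^sub>C h i) \<in> closure (cspan (range h))"
    using closure_subset by blast
qed

text \<open>If \<open>u\<close> has the coefficients along \<open>h\<close> and the norm of \<open>t\<close> times the image of \<open>v\<close>, it has no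
  component orthogonal to \<open>h\<close> and so equals that multiple of the image.\<close>

lemma antilinear_ext_eqI:
  assumes v: "v \<in> closure (cspan (range e))"
    and coeff: "\<And>i. cinner u (h i) = complex_of_real t * cnj (cinner v (e i))"
    and nrm: "norm u = t * norm v"
  shows "u = t *\<^sub>R antilinear_ext e h v"
proof -
  let ?r = "antilinear_ext e h"
  have eq: "cinner u' (?r w) = complex_of_real s * cinner w v"
    if u': "\<And>i. cinner u' (h i) = complex_of_real s * cnj (cinner v (e i))"
      and "w \<in> closure (cspan (range e))" for u' w s
  proof -
    let ?W = "{w. cinner u' (?r w) = complex_of_real s * cinner w v}"
    have "closure (cspan (range e)) \<subseteq> ?W"
    proof (rule csubspace_closed_spanI)
      show "csubspace ?W"
        unfolding csubspace_def
      proof (intro conjI ballI allI)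
        show "0 \<in> ?W" using antilinear_ext_antilinear[of 0 0 0 0] by simp
        fix v1 v2 assume "v1 \<in> ?W" "v2 \<in> ?W"
        then show "v1 + v2 \<in> ?W"
          using antilinear_ext_antilinear[of 1 v1 1 v2]
          by (simp add: cinner_add_right cinner_add_left distrib_left)
      next
        fix a w assume "w \<in> ?W"
        then show "a *\<^sub>C w \<in> ?W"
          using antilinear_ext_antilinear[of a w 0 0]
          by (simp add: cinner_scaleC_right cinner_scaleC_left)
      qed
      show "closed ?W"
        by (intro closed_Collect_eq continuous_intros continuous_on_antilinear_ext)
      show "range e \<subseteq> ?W"
        using u' by (auto simp: antilinear_ext_basis) (metis cinner_commute)
    qed
    then show ?thesis using that(2) by auto
  qed
  have "cinner (?r v) (h i) = complex_of_real 1 * cnj (cinner v (e i))" for i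
    by (metis cinner_antilinear_ext cinner_commute mult_1 of_real_1)
  from eq[OF this v] have "cinner (?r v) (?r v) = cinner v v" by simp
  then have rv: "norm (?r v) = norm v"
    unfolding cinner_self by (metis norm_ge_zero of_real_eq_iff power2_eq_imp_eq)
  have "cinner u (?r v) = complex_of_real t * cinner v v"
    by (rule eq[OF coeff v])
  then have "Re (cinner u (t *\<^sub>R ?r v)) = t * t * (norm v)\<^sup>2"
    by (simp add: cinner_scaleR_right cinner_self flip: of_real_mult of_real_power)
  then have "(norm (u - t *\<^sub>R ?r v))\<^sup>2 = 0"
    using norm_diff_square[of u "t *\<^sub>R ?r v"] rv nrm
    by (simp add: power_mult_distrib power2_eq_square)
  then show ?thesis by simp
qed

lemma norm_antilinear_ext:
  assumes "v \<in> closure (cspan (range e))"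
  shows "norm (antilinear_ext e h v) = norm v"
proof -
  let ?W = "{w. \<forall>u. cinner (antilinear_ext e h w) (antilinear_ext e h u) = cinner u w}"
  have "closure (cspan (range e)) \<subseteq> ?W"
  proof (rule csubspace_closed_spanI)
    show "csubspace ?W"
      unfolding csubspace_def
    proof (intro conjI ballI allI)
      show "0 \<in> ?W" using antilinear_ext_antilinear[of 0 0 0 0] by simp
      fix v1 v2 assume "v1 \<in> ?W" "v2 \<in> ?W"
      then show "v1 + v2 \<in> ?W"
        using antilinear_ext_antilinear[of 1 v1 1 v2]
        by (simp add: cinner_add_right cinner_add_left)
    next
      fix a w assume "w \<in> ?W"
      then show "a *\<^sub>C w \<in> ?W"
        using antilinear_ext_antilinear[of a w 0 0]
        by (simp add: cinner_scaleC_right cinner_scaleC_left)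
    qed
    show "closed ?W"
      by (intro closed_Collect_all closed_Collect_eq continuous_intros continuous_on_antilinear_ext)
    show "range e \<subseteq> ?W"
      by (auto simp: antilinear_ext_basis cinner_antilinear_ext)
  qed
  then have "cinner (antilinear_ext e h v) (antilinear_ext e h v) = cinner v v"
    using assms by auto
  then show ?thesis
    unfolding cinner_self by (metis norm_ge_zero of_real_eq_iff power2_eq_imp_eq)
qed

end

text \<open>An isometry that is linear (\<open>\<phi> a = a\<close>) or antilinear (\<open>\<phi> a = cnj a\<close>) is determined by its
  values on a total set.\<close>

lemma semilinear_isometry_eqI:
  fixes T T' :: "'v::complex_hilbert \<Rightarrow> 'v" and \<phi> :: "complex \<Rightarrow> complex" and B :: "'v set"
  defines "V \<equiv> closure (cspan B)"
  assumes \<phi>: "\<phi> 1 = 1" "\<phi> (-1) = -1" "\<phi> 0 = 0"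
    and lin: "\<And>a b v w. v \<in> V \<Longrightarrow> w \<in> V \<Longrightarrow> T (a *\<^sub>C v + b *\<^sub>C w) = \<phi> a *\<^sub>C T v + \<phi> b *\<^sub>C T w"
      "\<And>a b v w. v \<in> V \<Longrightarrow> w \<in> V \<Longrightarrow> T' (a *\<^sub>C v + b *\<^sub>C w) = \<phi> a *\<^sub>C T' v + \<phi> b *\<^sub>C T' w"
    and iso: "\<And>v. v \<in> V \<Longrightarrow> norm (T v) = norm v" "\<And>v. v \<in> V \<Longrightarrow> norm (T' v) = norm v"
    and eq: "\<And>b. b \<in> B \<Longrightarrow> T b = T' b"
    and v: "v \<in> V"
  shows "T v = T' v"
proof -
  have V: "csubspace V" unfolding V_def by (intro csubspace_closure csubspace_cspan)
  then have V0: "0 \<in> V" by (auto simp: csubspace_def)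
  let ?W = "{w \<in> V. T w = T' w}"
  have "closure (cspan B) \<subseteq> ?W"
  proof (rule csubspace_closed_spanI)
    show "csubspace ?W"
      unfolding csubspace_def
    proof (intro conjI ballI allI)
      show "0 \<in> ?W" using V0 lin[OF V0 V0, of 0 0] \<phi> by simp
      fix v w assume "v \<in> ?W" "w \<in> ?W"
      then show "v + w \<in> ?W"
        using V lin[of v w 1 1] \<phi> by (auto simp: csubspace_def)
    next
      fix a w assume "w \<in> ?W"
      then show "a *\<^sub>C w \<in> ?W"
        using V lin[of w 0 a 0] \<phi> V0 by (auto simp: csubspace_def)
    qed
    show "B \<subseteq> ?W"
      using eq cspan_superset[of B] closure_subset[of "cspan B"] by (auto simp: V_def)
    have diff: "norm (T v - T w) = norm (v - w)" "norm (T' v - T' w) = norm (v - w)"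
      if "v \<in> V" "w \<in> V" for v w
    proof -
      have d: "v - w = 1 *\<^sub>C v + (-1) *\<^sub>C w" by (simp add: scaleC_minus_one)
      have "1 *\<^sub>C v + (-1) *\<^sub>C w \<in> V"
        using V that unfolding csubspace_def by blast
      then have vw: "v - w \<in> V" by (simp only: d)
      have "T (v - w) = T v - T w" "T' (v - w) = T' v - T' w"
        unfolding d lin(1)[OF that] lin(2)[OF that] by (simp_all add: scaleC_minus_one \<phi>)
      then show "norm (T v - T w) = norm (v - w)" "norm (T' v - T' w) = norm (v - w)"
        using iso(1)[OF vw] iso(2)[OF vw] by simp_all
    qed
    show "closed ?W"
      unfolding closed_sequential_limits
    proof (intro allI impI)
      fix f w assume fw: "(\<forall>n. f n \<in> ?W) \<and> f \<longlonglongrightarrow> w"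
      have w: "w \<in> V"
        using closed_sequentially[of V f w] fw by (simp add: V_def)
      have lim: "(\<lambda>n. norm (f n - w)) \<longlonglongrightarrow> 0"
        using fw by (intro tendsto_norm_zero LIM_zero) simp
      have f: "f n \<in> V" "T' (f n) = T (f n)" for n using fw by auto
      have "(\<lambda>n. norm (T (f n) - T w)) \<longlonglongrightarrow> 0" "(\<lambda>n. norm (T' (f n) - T' w)) \<longlonglongrightarrow> 0"
        using lim diff[OF f(1) w] by simp_all
      then have "(\<lambda>n. T (f n)) \<longlonglongrightarrow> T w" "(\<lambda>n. T (f n)) \<longlonglongrightarrow> T' w"
        unfolding f(2) by (auto intro: LIM_zero_cancel tendsto_norm_zero_cancel)
      then show "w \<in> ?W" using w LIMSEQ_unique by blast
    qed
  qed
  then show ?thesis using v by (auto simp: V_def)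
qed

lemma
  assumes "antilinear_isometry_between V W T"
  shows antilinear_isometry_mem: "v \<in> V \<Longrightarrow> T v \<in> W"
    and antilinear_isometry_norm: "v \<in> V \<Longrightarrow> norm (T v) = norm v"
    and antilinear_isometry_combination:
      "v \<in> V \<Longrightarrow> w \<in> V \<Longrightarrow> T (a *\<^sub>C v + b *\<^sub>C w) = cnj a *\<^sub>C T v + cnj b *\<^sub>C T w"
  using assms by (auto simp: antilinear_isometry_between_def)

lemma antilinear_isometry_scaleC:
  assumes "antilinear_isometry_between V W T" "v \<in> V"
  shows "T (a *\<^sub>C v) = cnj a *\<^sub>C T v"
  using antilinear_isometry_combination[OF assms(1,2,2), of a 0] by simp

lemma antilinear_isometry_scaleR:
  assumes "antilinear_isometry_between V W T" "v \<in> V"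
  shows "T (t *\<^sub>R v) = t *\<^sub>R T v"
  using antilinear_isometry_scaleC[OF assms, of "complex_of_real t"] by (simp add: scaleC_of_real)

lemma
  assumes "unitary_between V W T"
  shows unitary_mem: "v \<in> V \<Longrightarrow> T v \<in> W"
    and unitary_combination:
      "v \<in> V \<Longrightarrow> w \<in> V \<Longrightarrow> T (a *\<^sub>C v + b *\<^sub>C w) = a *\<^sub>C T v + b *\<^sub>C T w"
  using assms by (auto simp: unitary_between_def)

lemma unitary_norm:
  assumes "unitary_between V W T" "v \<in> V"
  shows "norm (T v) = norm v"
proof -
  have "cinner (T v) (T v) = cinner v v" using assms by (simp add: unitary_between_def)
  then show ?thesis
    unfolding cinner_self by (metis norm_ge_zero of_real_eq_iff power2_eq_imp_eq)
qed

lemma unitary_scaleC: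
  assumes "unitary_between V W T" "v \<in> V"
  shows "T (a *\<^sub>C v) = a *\<^sub>C T v"
  using unitary_combination[OF assms(1,2,2), of a 0] by simp

lemma unitary_scaleR:
  assumes "unitary_between V W T" "v \<in> V"
  shows "T (t *\<^sub>R v) = t *\<^sub>R T v"
  using unitary_scaleC[OF assms, of "complex_of_real t"] by (simp add: scaleC_of_real)

section \<open>Nonsingular involutions of a measure space\<close>

text \<open>It is enough to ask that null sets have null preimages: as \<open>T\<close> is an involution, the image
  measure is then equivalent to \<open>M\<close>.\<close>

locale nonsingular_involution = sigma_finite_measure M for M :: "'x measure" +
  fixes T :: "'x \<Rightarrow> 'x"
  assumes T_measurable [measurable]: "T \<in> measurable M M"
    and T_T: "\<And>x. x \<in> space M \<Longrightarrow> T (T x) = x"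
    and nonsingular: "absolutely_continuous M (distr M M T)"
begin

text \<open>The density of the image measure, as a real function. No generality is lost: the image measure
  is \<open>\<sigma>\<close>-finite, so the extended-real density is finite almost everywhere.\<close>

definition jac :: "'x \<Rightarrow> real" where
  "jac x = enn2real (RN_deriv M (distr M M T) x)"

lemma jac_measurable [measurable]: "jac \<in> borel_measurable M"
  unfolding jac_def by measurable

lemma jac_nonneg [simp]: "0 \<le> jac x"
  by (simp add: jac_def)

lemma T_space: "x \<in> space M \<Longrightarrow> T x \<in> space M"
  by (rule measurable_space[OF T_measurable])

lemma AE_T:
  assumes "AE x in M. P x"
  shows "AE x in M. P (T x)"
proof -
  have "AE x in distr M M T. P x"
    by (rule absolutely_continuous_AE[OF _ nonsingular assms]) simp
  then show ?thesis by (rule AE_distrD[rotated]) simp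
qed

lemma absolutely_continuous_distr_T: "absolutely_continuous (distr M M T) M"
  unfolding absolutely_continuous_def
proof
  fix E assume E: "E \<in> null_sets (distr M M T)"
  then have [measurable]: "E \<in> sets M" by auto
  have "AE x in distr M M T. x \<notin> E" by (rule AE_not_in[OF E])
  then have "AE x in M. T x \<notin> E" by (rule AE_distrD[rotated]) simp
  from AE_T[OF this] have "AE x in M. x \<notin> E"
    using AE_space by eventually_elim (simp add: T_T)
  then show "E \<in> null_sets M"
    using AE_iff_null_sets[of E M] by simp
qed

lemma sigma_finite_distr_T: "sigma_finite_measure (distr M M T)"
proof
  obtain F where F: "countable F" "F \<subseteq> sets M" "\<Union>F = space M" "\<And>a. a \<in> F \<Longrightarrow> emeasure M a \<noteq> \<infinity>"
    using sigma_finite_countable by blast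
  show "\<exists>A. countable A \<and> A \<subseteq> sets (distr M M T) \<and> \<Union>A = space (distr M M T) \<and>
      (\<forall>a\<in>A. emeasure (distr M M T) a \<noteq> \<infinity>)"
  proof (intro exI[of _ "(\<lambda>A. T -` A \<inter> space M) ` F"] conjI ballI)
    show "\<Union>((\<lambda>A. T -` A \<inter> space M) ` F) = space (distr M M T)"
      using T_space by (auto simp flip: F(3))
  next
    fix a assume "a \<in> (\<lambda>A. T -` A \<inter> space M) ` F"
    then obtain A where A: "A \<in> F" "a = T -` A \<inter> space M" by auto
    have "A \<subseteq> space M" using A F(2) sets.sets_into_space by blast
    then have "T -` (T -` A \<inter> space M) \<inter> space M = A"
      by (auto simp: T_T T_space subset_iff)
    then show "emeasure (distr M M T) a \<noteq> \<infinity>"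
      using A F(2,4) by (subst emeasure_distr) auto
  qed (use F in auto)
qed

lemma ennreal_jac: "AE x in M. RN_deriv M (distr M M T) x = ennreal (jac x)"
  using RN_deriv_finite[OF sigma_finite_distr_T nonsingular]
  by (auto simp: jac_def less_top)

lemma nn_integral_T:
  assumes [measurable]: "f \<in> borel_measurable M"
  shows "(\<integral>\<^sup>+x. ennreal (jac x) * f (T x) \<partial>M) = (\<integral>\<^sup>+x. f x \<partial>M)"
proof -
  have "(\<integral>\<^sup>+x. ennreal (jac x) * f (T x) \<partial>M) = (\<integral>\<^sup>+x. RN_deriv M (distr M M T) x * f (T x) \<partial>M)"
    using ennreal_jac by (intro nn_integral_cong_AE) auto
  also have "\<dots> = (\<integral>\<^sup>+x. f (T x) \<partial>distr M M T)"
    by (rule RN_deriv_nn_integral[symmetric]) (auto intro: nonsingular)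
  also have "\<dots> = (\<integral>\<^sup>+x. f (T (T x)) \<partial>M)"
    by (rule nn_integral_distr) auto
  also have "\<dots> = (\<integral>\<^sup>+x. f x \<partial>M)"
    by (intro nn_integral_cong) (simp add: T_T)
  finally show ?thesis .
qed

lemma integrable_T:
  fixes f :: "'x \<Rightarrow> real"
  assumes f: "integrable M f" "\<And>x. 0 \<le> f x"
  shows "integrable M (\<lambda>x. jac x * f (T x))"
    and "(LINT x|M. jac x * f (T x)) = (LINT x|M. f x)"
proof -
  have [measurable]: "f \<in> borel_measurable M" using f by auto
  have eq: "(\<integral>\<^sup>+x. ennreal (jac x * f (T x)) \<partial>M) = (\<integral>\<^sup>+x. ennreal (f x) \<partial>M)"
    using nn_integral_T[of "\<lambda>x. ennreal (f x)"] by (simp add: ennreal_mult' f(2))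
  also have "\<dots> < \<infinity>"
    using f by (subst nn_integral_eq_integral) auto
  finally show "integrable M (\<lambda>x. jac x * f (T x))"
    by (intro integrableI_nonneg) (auto simp: f(2))
  show "(LINT x|M. jac x * f (T x)) = (LINT x|M. f x)"
    unfolding integral_eq_nn_integral[of f M, OF \<open>f \<in> borel_measurable M\<close> AE_I2[OF f(2)]]
    by (subst integral_eq_nn_integral) (auto simp: f(2) eq)
qed

end

lemma (in sigma_finite_measure) AE_eqI_nn_integral:
  assumes [measurable]: "g \<in> borel_measurable M" "h \<in> borel_measurable M"
    and eq: "\<And>f. f \<in> borel_measurable M \<Longrightarrow> (\<integral>\<^sup>+x. g x * f x \<partial>M) = (\<integral>\<^sup>+x. h x * f x \<partial>M)"
  shows "AE x in M. g x = h x"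
proof (rule density_unique)
  show "density M g = density M h"
    by (rule measure_eqI) (auto simp: emeasure_density eq)
qed measurable

context nonsingular_involution
begin

lemma jac_T: "AE x in M. jac x * jac (T x) = 1"
proof -
  have "AE x in M. ennreal (jac x) * ennreal (jac (T x)) = 1"
  proof (rule AE_eqI_nn_integral)
    fix f :: "'x \<Rightarrow> ennreal" assume [measurable]: "f \<in> borel_measurable M"
    have "(\<integral>\<^sup>+x. ennreal (jac x) * ennreal (jac (T x)) * f x \<partial>M)
        = (\<integral>\<^sup>+x. ennreal (jac x) * (ennreal (jac (T x)) * f (T (T x))) \<partial>M)"
      by (intro nn_integral_cong) (simp add: T_T mult.assoc)
    also have "\<dots> = (\<integral>\<^sup>+x. ennreal (jac x) * f (T x) \<partial>M)"
      by (rule nn_integral_T[of "\<lambda>x. ennreal (jac x) * f (T x)"]) measurable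
    also have "\<dots> = (\<integral>\<^sup>+x. 1 * f x \<partial>M)"
      by (simp add: nn_integral_T)
    finally show "(\<integral>\<^sup>+x. ennreal (jac x) * ennreal (jac (T x)) * f x \<partial>M) = (\<integral>\<^sup>+x. 1 * f x \<partial>M)" .
  qed measurable
  then show ?thesis
    by eventually_elim (simp flip: ennreal_mult' ennreal_1)
qed

lemma jac_pos: "AE x in M. 0 < jac x"
  using jac_T by eventually_elim (metis jac_nonneg less_eq_real_def mult_zero_left zero_neq_one)

end

text \<open>Both sides are the density of the image of the measure under \<open>T \<circ> U\<close>.\<close>

lemma jac_cocycle:
  fixes T U :: "'x \<Rightarrow> 'x"
  assumes "nonsingular_involution M T" "nonsingular_involution M U"
    and comm: "\<And>x. x \<in> space M \<Longrightarrow> T (U x) = U (T x)"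
  shows "AE x in M. nonsingular_involution.jac M T x * nonsingular_involution.jac M U (T x) =
    nonsingular_involution.jac M U x * nonsingular_involution.jac M T (U x)"
proof -
  interpret T: nonsingular_involution M T by fact
  interpret U: nonsingular_involution M U by fact
  have "AE x in M. ennreal (T.jac x) * ennreal (U.jac (T x)) = ennreal (U.jac x) * ennreal (T.jac (U x))"
  proof (rule T.AE_eqI_nn_integral)
    fix f :: "'x \<Rightarrow> ennreal" assume [measurable]: "f \<in> borel_measurable M"
    define g where "g x = f (T (U x))" for x
    have [measurable]: "g \<in> borel_measurable M" unfolding g_def by measurable
    have gf: "g (U (T x)) = f x" "g (T (U x)) = f x" if "x \<in> space M" for x
      using that by (simp_all add: g_def U.T_T T.T_T T.T_space U.T_space comm)
    have "(\<integral>\<^sup>+x. ennreal (T.jac x) * ennreal (U.jac (T x)) * f x \<partial>M)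
        = (\<integral>\<^sup>+x. ennreal (T.jac x) * (ennreal (U.jac (T x)) * g (U (T x))) \<partial>M)"
      by (intro nn_integral_cong) (simp add: gf mult.assoc)
    also have "\<dots> = (\<integral>\<^sup>+x. g x \<partial>M)"
      using T.nn_integral_T[of "\<lambda>x. ennreal (U.jac x) * g (U x)"] U.nn_integral_T[of g] by simp
    also have "\<dots> = (\<integral>\<^sup>+x. ennreal (U.jac x) * (ennreal (T.jac (U x)) * g (T (U x))) \<partial>M)"
      using U.nn_integral_T[of "\<lambda>x. ennreal (T.jac x) * g (T x)"] T.nn_integral_T[of g] by simp
    also have "\<dots> = (\<integral>\<^sup>+x. ennreal (U.jac x) * ennreal (T.jac (U x)) * f x \<partial>M)"
      by (intro nn_integral_cong) (simp add: gf mult.assoc)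
    finally show "(\<integral>\<^sup>+x. ennreal (T.jac x) * ennreal (U.jac (T x)) * f x \<partial>M) =
      (\<integral>\<^sup>+x. ennreal (U.jac x) * ennreal (T.jac (U x)) * f x \<partial>M)" .
  qed measurable
  then show ?thesis
    by eventually_elim (simp flip: ennreal_mult')
qed

section \<open>Measurable fields of Hilbert spaces and their direct integral\<close>

text \<open>The measurable field of nonzero Hilbert spaces \<open>x \<mapsto> \<H> (\<nu> x)\<close> over a \<open>\<sigma>\<close>-finite measure
  space.\<close>

locale hilbert_field = sigma_finite_measure M for M :: "'x measure" +
  fixes \<H> :: "enat \<Rightarrow> 'v::{complex_hilbert, second_countable_topology} set" and \<nu> :: "'x \<Rightarrow> enat"
  assumes dim_measurable [measurable]: "\<nu> \<in> measurable M (count_space UNIV)"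
    and dim_pos: "\<And>x. x \<in> space M \<Longrightarrow> 1 \<le> \<nu> x"
    and hilbert_dim: "\<And>n. 1 \<le> n \<Longrightarrow> has_hilbert_dim (\<H> n) n"
begin

text \<open>Square-integrable fields, their almost-everywhere classes, and the direct integral.\<close>

abbreviation "L2 \<equiv> L2_fields \<H> M \<nu>"
abbreviation "cl \<equiv> ae_class \<H> M \<nu>"
abbreviation "DI \<equiv> direct_integral \<H> M \<nu>"

text \<open>An orthonormal basis of each fibre, chosen once for all points with the same \<open>\<nu> x\<close>.\<close>

definition basis :: "enat \<Rightarrow> nat \<Rightarrow> 'v" where
  "basis n = (SOME e. orthonormal_on {i. enat i < n} e \<and> \<H> n = closure (cspan (range e)))"

lemma
  assumes "1 \<le> n"
  shows basis_orthonormal: "orthonormal_on {i. enat i < n} (basis n)"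
    and fibre_eq_span: "\<H> n = closure (cspan (range (basis n)))"
proof -
  have "\<exists>e. orthonormal_on {i. enat i < n} e \<and> \<H> n = closure (cspan (range e))"
    using has_hilbert_dimE[OF hilbert_dim[OF assms]] by metis
  from someI_ex[OF this] show "orthonormal_on {i. enat i < n} (basis n)"
    "\<H> n = closure (cspan (range (basis n)))" by (simp_all add: basis_def)
qed

lemma csubspace_fibre: "1 \<le> n \<Longrightarrow> csubspace (\<H> n)"
  by (simp add: fibre_eq_span csubspace_closure csubspace_cspan)

lemma closed_fibre: "1 \<le> n \<Longrightarrow> closed (\<H> n)"
  by (simp add: fibre_eq_span)

lemma basis_mem: "1 \<le> n \<Longrightarrow> basis n i \<in> \<H> n"
  using cspan_superset[of "range (basis n)"] closure_subset[of "cspan (range (basis n))"]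
  by (auto simp: fibre_eq_span)

lemma basis_measurable [measurable]: "(\<lambda>x. basis (\<nu> x) i) \<in> borel_measurable M"
  by (rule measurable_compose[OF dim_measurable]) simp

lemma zero_mem_fibre [simp]: "1 \<le> n \<Longrightarrow> 0 \<in> \<H> n"
  using csubspace_fibre[of n] by (simp add: csubspace_def)

lemma scaleC_mem_fibre: "1 \<le> n \<Longrightarrow> v \<in> \<H> n \<Longrightarrow> a *\<^sub>C v \<in> \<H> n"
  using csubspace_fibre[of n] by (simp add: csubspace_def)

lemma L2_measurable: "f \<in> L2 \<Longrightarrow> f \<in> borel_measurable M"
  by (simp add: L2_fields_def measurable_fields_def)

lemma L2_fibre: "f \<in> L2 \<Longrightarrow> x \<in> space M \<Longrightarrow> f x \<in> \<H> (\<nu> x)"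
  by (simp add: L2_fields_def measurable_fields_def)

lemma L2_integrable: "f \<in> L2 \<Longrightarrow> integrable M (\<lambda>x. (norm (f x))\<^sup>2)"
  by (simp add: L2_fields_def)

lemma L2_I:
  assumes "f \<in> borel_measurable M" "\<And>x. x \<in> space M \<Longrightarrow> f x \<in> \<H> (\<nu> x)"
    and "integrable M (\<lambda>x. (norm (f x))\<^sup>2)"
  shows "f \<in> L2"
  using assms by (simp add: L2_fields_def measurable_fields_def)

lemma L2_mult:
  assumes f: "f \<in> L2" and a [measurable]: "a \<in> borel_measurable M"
    and B: "\<And>x. x \<in> space M \<Longrightarrow> cmod (a x) \<le> B"
  shows "(\<lambda>x. a x *\<^sub>C f x) \<in> L2"
proof (rule L2_I)
  note [measurable] = L2_measurable[OF f]
  show "(\<lambda>x. a x *\<^sub>C f x) \<in> borel_measurable M" by measurable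
  show "a x *\<^sub>C f x \<in> \<H> (\<nu> x)" if "x \<in> space M" for x
    using that by (intro scaleC_mem_fibre dim_pos L2_fibre f)
  show "integrable M (\<lambda>x. (norm (a x *\<^sub>C f x))\<^sup>2)"
  proof (rule Bochner_Integration.integrable_bound)
    show "integrable M (\<lambda>x. B\<^sup>2 * (norm (f x))\<^sup>2)"
      using L2_integrable[OF f] by simp
    show "AE x in M. norm ((norm (a x *\<^sub>C f x))\<^sup>2) \<le> norm (B\<^sup>2 * (norm (f x))\<^sup>2)"
      using B by (intro AE_I2) (auto simp: norm_scaleC power_mult_distrib intro!: mult_right_mono power_mono)
  qed measurable
qed

lemma L2_add:
  assumes f: "f \<in> L2" and g: "g \<in> L2"
  shows "(\<lambda>x. f x + g x) \<in> L2"
proof (rule L2_I)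
  note [measurable] = L2_measurable[OF f] L2_measurable[OF g]
  show "(\<lambda>x. f x + g x) \<in> borel_measurable M" by measurable
  show "f x + g x \<in> \<H> (\<nu> x)" if "x \<in> space M" for x
    using csubspace_fibre[OF dim_pos[OF that]] L2_fibre[OF f that] L2_fibre[OF g that]
    by (simp add: csubspace_def)
  show "integrable M (\<lambda>x. (norm (f x + g x))\<^sup>2)"
  proof (rule Bochner_Integration.integrable_bound)
    show "integrable M (\<lambda>x. 2 * (norm (f x))\<^sup>2 + 2 * (norm (g x))\<^sup>2)"
      using L2_integrable[OF f] L2_integrable[OF g] by simp
    show "AE x in M. norm ((norm (f x + g x))\<^sup>2) \<le> norm (2 * (norm (f x))\<^sup>2 + 2 * (norm (g x))\<^sup>2)"
      using norm_add_square_le by (intro AE_I2) auto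
  qed measurable
qed

lemma L2_scale: "f \<in> L2 \<Longrightarrow> (\<lambda>x. a *\<^sub>C f x) \<in> L2"
  by (rule L2_mult[where B="cmod a"]) auto

lemma L2_combination: "f \<in> L2 \<Longrightarrow> g \<in> L2 \<Longrightarrow> (\<lambda>x. a *\<^sub>C f x + b *\<^sub>C g x) \<in> L2"
  by (intro L2_add L2_scale)

lemma L2_diff: "f \<in> L2 \<Longrightarrow> g \<in> L2 \<Longrightarrow> (\<lambda>x. f x - g x) \<in> L2"
  using L2_combination[of f g 1 "-1"] by (simp add: scaleC_minus_one)

lemma cl_mem: "f \<in> L2 \<Longrightarrow> f \<in> cl f"
  by (simp add: ae_class_def)

lemma cl_cong: "AE x in M. f x = g x \<Longrightarrow> cl f = cl g"
  unfolding ae_class_def by (intro Collect_cong conj_cong refl iffI; elim AE_mp; auto)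

lemma cl_eq_iff: "f \<in> L2 \<Longrightarrow> cl f = cl g \<longleftrightarrow> (AE x in M. f x = g x)"
  using cl_mem[of f] cl_cong[of f g] by (auto simp: ae_class_def)

lemma carrier_DI: "carrier DI = cl ` L2"
  by (simp add: direct_integral_def Let_def)

lemma cl_carrier: "f \<in> L2 \<Longrightarrow> cl f \<in> carrier DI"
  by (simp add: carrier_DI)

text \<open>The representative of a class that the operations of the direct integral are defined with.\<close>

definition rep :: "('x \<Rightarrow> 'v) set \<Rightarrow> 'x \<Rightarrow> 'v" where
  "rep F = (SOME f. f \<in> F)"

lemma rep_mem: "F \<in> carrier DI \<Longrightarrow> rep F \<in> F"
  unfolding rep_def carrier_DI using cl_mem someI_ex[of "\<lambda>f. f \<in> F"] by blast

lemma mem_L2: "F \<in> carrier DI \<Longrightarrow> f \<in> F \<Longrightarrow> f \<in> L2"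
  by (auto simp: carrier_DI ae_class_def)

lemma rep_L2: "F \<in> carrier DI \<Longrightarrow> rep F \<in> L2"
  by (rule mem_L2[OF _ rep_mem])

lemma mem_carrier_eq_cl: "F \<in> carrier DI \<Longrightarrow> f \<in> F \<Longrightarrow> F = cl f"
  by (auto simp: carrier_DI ae_class_def intro: cl_cong[unfolded ae_class_def])

lemma cl_rep: "F \<in> carrier DI \<Longrightarrow> cl (rep F) = F"
  using mem_carrier_eq_cl rep_mem by blast

lemma rep_cl: "f \<in> L2 \<Longrightarrow> AE x in M. rep (cl f) x = f x"
  using rep_mem[OF cl_carrier, of f] by (simp add: ae_class_def)

lemma hadd_cl:
  assumes "f \<in> L2" "g \<in> L2"
  shows "hadd DI (cl f) (cl g) = cl (\<lambda>x. f x + g x)"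
  using rep_cl[OF assms(1)] rep_cl[OF assms(2)]
  by (simp add: direct_integral_def Let_def flip: rep_def) (rule cl_cong, auto)

lemma hscale_cl:
  assumes "f \<in> L2"
  shows "hscale DI a (cl f) = cl (\<lambda>x. a *\<^sub>C f x)"
  using rep_cl[OF assms]
  by (simp add: direct_integral_def Let_def flip: rep_def) (rule cl_cong, auto)

lemma combination_cl:
  assumes "f \<in> L2" "g \<in> L2"
  shows "hadd DI (hscale DI a (cl f)) (hscale DI b (cl g)) = cl (\<lambda>x. a *\<^sub>C f x + b *\<^sub>C g x)"
  using assms by (simp add: hscale_cl hadd_cl L2_scale)

lemma hinner_cl:
  assumes "f \<in> L2" "g \<in> L2"
  shows "hinner DI (cl f) (cl g) = (LINT x|M. cinner (f x) (g x))"
proof -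
  have [measurable]: "rep (cl f) \<in> borel_measurable M" "rep (cl g) \<in> borel_measurable M"
    "f \<in> borel_measurable M" "g \<in> borel_measurable M"
    using assms by (auto intro: L2_measurable rep_L2 cl_carrier)
  have "(LINT x|M. cinner (rep (cl f) x) (rep (cl g) x)) = (LINT x|M. cinner (f x) (g x))"
    by (rule integral_cong_AE) (use rep_cl[OF assms(1)] rep_cl[OF assms(2)] in auto)
  then show ?thesis by (simp add: direct_integral_def Let_def rep_def)
qed

lemma hnorm_cl:
  assumes "f \<in> L2"
  shows "hnorm DI (cl f) = sqrt (LINT x|M. (norm (f x))\<^sup>2)"
  by (simp add: hnorm_def hinner_cl[OF assms assms] cinner_self del: of_real_power)

lemma L2_AE_zero:
  assumes "f \<in> L2" "(LINT x|M. (norm (f x))\<^sup>2) \<le> 0"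
  shows "AE x in M. f x = 0"
proof -
  have "(LINT x|M. (norm (f x))\<^sup>2) = 0"
    using assms(2) by (simp add: order_antisym integral_nonneg_AE)
  then have "AE x in M. (norm (f x))\<^sup>2 = 0"
    using integral_nonneg_eq_0_iff_AE[OF L2_integrable[OF assms(1)]] by simp
  then show ?thesis by simp
qed

lemma integral_norm_square_cong:
  assumes "f \<in> L2" "g \<in> L2" "AE x in M. f x = g x"
  shows "(LINT x|M. (norm (f x))\<^sup>2) = (LINT x|M. (norm (g x))\<^sup>2)"
proof -
  note [measurable] = L2_measurable[OF assms(1)] L2_measurable[OF assms(2)]
  show ?thesis by (rule integral_cong_AE) (use assms(3) in auto)
qed

text \<open>A strictly positive square-integrable function. It turns the bases of the fibres into
  square-integrable fields even if the measure is infinite.\<close>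

definition weight :: "'x \<Rightarrow> real" where
  "weight = (SOME w. w \<in> borel_measurable M \<and> (\<forall>x\<in>space M. 0 < w x) \<and> integrable M (\<lambda>x. (w x)\<^sup>2))"

lemma
  shows weight_measurable [measurable]: "weight \<in> borel_measurable M"
    and weight_pos: "x \<in> space M \<Longrightarrow> 0 < weight x"
    and weight_integrable: "integrable M (\<lambda>x. (weight x)\<^sup>2)"
proof -
  obtain h :: "'x \<Rightarrow> real" where h [measurable]: "h \<in> borel_measurable M"
    and pos: "\<And>x. 0 < h x" and "\<And>x. h x \<le> 1" and "integrable M h"
    by (rule obtain_positive_integrable_function) (rule that)
  then have "integrable M (\<lambda>x. (sqrt (h x))\<^sup>2)"
    by (simp add: less_imp_le)
  then have "\<exists>w. w \<in> borel_measurable M \<and> (\<forall>x\<in>space M. (0::real) < w x) \<and> integrable M (\<lambda>x. (w x)\<^sup>2)"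
    using pos by (intro exI[of _ "\<lambda>x. sqrt (h x)"]) auto
  note w = someI_ex[OF this, folded weight_def]
  show "weight \<in> borel_measurable M" "integrable M (\<lambda>x. (weight x)\<^sup>2)"
    "x \<in> space M \<Longrightarrow> 0 < weight x" using w by auto
qed

definition basis_field :: "nat \<Rightarrow> 'x \<Rightarrow> 'v" where
  "basis_field i x = weight x *\<^sub>R basis (\<nu> x) i"

lemma basis_field_L2: "basis_field i \<in> L2"
proof (rule L2_I)
  show [measurable]: "basis_field i \<in> borel_measurable M"
    unfolding basis_field_def by measurable
  show "basis_field i x \<in> \<H> (\<nu> x)" if "x \<in> space M" for x
    unfolding basis_field_def using that
    by (metis scaleC_of_real scaleC_mem_fibre dim_pos basis_mem)
  show "integrable M (\<lambda>x. (norm (basis_field i x))\<^sup>2)"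
  proof (rule Bochner_Integration.integrable_bound[OF weight_integrable])
    have "norm (basis (\<nu> x) i) \<le> 1" if "x \<in> space M" for x
      using orthonormal_on_norm[OF basis_orthonormal[OF dim_pos[OF that]], of i]
        orthonormal_on_zero[OF basis_orthonormal[OF dim_pos[OF that]], of i]
      by (cases "enat i < \<nu> x") auto
    then show "AE x in M. norm ((norm (basis_field i x))\<^sup>2) \<le> norm ((weight x)\<^sup>2)"
      by (intro AE_I2) (auto simp: basis_field_def power_mult_distrib power_le_one
          intro!: mult_left_le)
  qed measurable
qed

lemma basis_field_0_nonzero: "x \<in> space M \<Longrightarrow> basis_field 0 x \<noteq> 0"
  using orthonormal_on_norm[OF basis_orthonormal[OF dim_pos], of x 0] dim_pos[of x] weight_pos[of x]
  by (auto simp: basis_field_def enat_0 one_enat_def Suc_ile_eq iless_eSuc0 order_less_le_trans[of 0 1])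

text \<open>A field whose values lie in the fibres only almost everywhere can be corrected on a null set.\<close>

lemma measurable_fields_modify:
  assumes f: "f \<in> borel_measurable M" "AE x in M. f x \<in> \<H> (\<nu> x)"
  obtains g where "g \<in> measurable_fields \<H> M \<nu>" "AE x in M. g x = f x"
proof -
  obtain N where N: "N \<in> null_sets M" "\<And>x. x \<in> space M \<Longrightarrow> x \<notin> N \<Longrightarrow> f x \<in> \<H> (\<nu> x)"
    using f(2) by (auto simp: eventually_ae_filter)
  then have [measurable]: "N \<in> sets M" "f \<in> borel_measurable M" using f by auto
  let ?g = "\<lambda>x. if x \<in> N then 0 else f x"
  have "?g \<in> measurable_fields \<H> M \<nu>"
    unfolding measurable_fields_def using N(2) dim_pos by auto
  moreover have "AE x in M. ?g x = f x"
    using AE_not_in[OF N(1)] by eventually_elim auto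
  ultimately show ?thesis using that by blast
qed

lemma L2_modify:
  assumes f: "f \<in> borel_measurable M" "AE x in M. f x \<in> \<H> (\<nu> x)" "integrable M (\<lambda>x. (norm (f x))\<^sup>2)"
  obtains g where "g \<in> L2" "AE x in M. g x = f x"
proof -
  obtain g where g: "g \<in> measurable_fields \<H> M \<nu>" "AE x in M. g x = f x"
    using measurable_fields_modify[OF f(1,2)] by blast
  have [measurable]: "f \<in> borel_measurable M" "g \<in> borel_measurable M"
    using f(1) g(1) by (auto simp: measurable_fields_def)
  have "integrable M (\<lambda>x. (norm (g x))\<^sup>2)"
    by (rule integrable_cong_AE_imp[OF f(3)]) (use g(2) in auto)
  then show ?thesis using that g by (auto simp: L2_fields_def)
qed

end

section \<open>Real structures on a direct integral\<close>

text \<open>A norm-preserving antilinear involution of the direct integral, described by its action on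
  fields instead of classes.\<close>

locale field_real_structure = hilbert_field +
  fixes s :: "('a \<Rightarrow> 'b) \<Rightarrow> 'a \<Rightarrow> 'b"
  assumes s_L2: "\<And>f. f \<in> L2 \<Longrightarrow> s f \<in> L2"
    and s_cong: "\<And>f g. f \<in> L2 \<Longrightarrow> g \<in> L2 \<Longrightarrow> AE x in M. f x = g x \<Longrightarrow> AE x in M. s f x = s g x"
    and s_antilinear: "\<And>a b f g. f \<in> L2 \<Longrightarrow> g \<in> L2 \<Longrightarrow>
      AE x in M. s (\<lambda>x. a *\<^sub>C f x + b *\<^sub>C g x) x = cnj a *\<^sub>C s f x + cnj b *\<^sub>C s g x"
    and s_s: "\<And>f. f \<in> L2 \<Longrightarrow> AE x in M. s (s f) x = f x"
    and s_norm: "\<And>f. f \<in> L2 \<Longrightarrow> (LINT x|M. (norm (s f x))\<^sup>2) = (LINT x|M. (norm (f x))\<^sup>2)"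
begin

lemma s_class:
  assumes "F \<in> carrier DI" "f \<in> F"
  shows "cl (s (rep F)) = cl (s f)"
proof (rule cl_cong[OF s_cong])
  show "AE x in M. rep F x = f x"
    using cl_eq_iff[OF rep_L2[OF assms(1)], of f] cl_rep[OF assms(1)] mem_carrier_eq_cl[OF assms]
    by simp
qed (use assms in \<open>auto intro: rep_L2 mem_L2\<close>)

lemma s_class_cl: "f \<in> L2 \<Longrightarrow> cl (s (rep (cl f))) = cl (s f)"
  using s_class[OF cl_carrier cl_mem] by blast

lemma invariant_real_structureI:
  assumes J: "\<And>z F. F \<in> carrier DI \<Longrightarrow> J z F \<in> carrier DI"
    and comm: "\<And>z f. f \<in> L2 \<Longrightarrow> cl (s (rep (J z (cl f)))) = J z (cl (s f))"
  shows "invariant_real_structure DI J (\<lambda>F. cl (s (rep F)))"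
proof -
  have "cl (s (rep (cl (s (rep F))))) = F" "hnorm DI (cl (s (rep F))) = hnorm DI F"
    if "F \<in> carrier DI" for F
  proof -
    note f = rep_L2[OF that]
    have "cl (s (rep (cl (s (rep F))))) = cl (rep F)"
      using s_class_cl[OF s_L2[OF f]] cl_cong[OF s_s[OF f]] by simp
    then show "cl (s (rep (cl (s (rep F))))) = F" by (simp add: cl_rep that)
    have "hnorm DI (cl (s (rep F))) = hnorm DI (cl (rep F))"
      using f by (simp add: hnorm_cl s_L2 s_norm)
    then show "hnorm DI (cl (s (rep F))) = hnorm DI F" by (simp add: cl_rep that)
  qed
  moreover have "cl (s (rep (hadd DI (hscale DI a F) (hscale DI b G)))) =
      hadd DI (hscale DI (cnj a) (cl (s (rep F)))) (hscale DI (cnj b) (cl (s (rep G))))"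
    if "F \<in> carrier DI" "G \<in> carrier DI" for F G a b
  proof -
    note f = rep_L2[OF that(1)] and g = rep_L2[OF that(2)]
    have "hadd DI (hscale DI a F) (hscale DI b G) = cl (\<lambda>x. a *\<^sub>C rep F x + b *\<^sub>C rep G x)"
      using combination_cl[OF f g, of a b] by (simp add: cl_rep that)
    then show ?thesis
      using s_class_cl[OF L2_combination[OF f g, of a b]] cl_cong[OF s_antilinear[OF f g, of a b]]
      by (simp add: combination_cl s_L2 f g)
  qed
  moreover have "cl (s (rep (J z F))) = J z (cl (s (rep F)))" if "F \<in> carrier DI" for z F
    using comm[OF rep_L2[OF that]] by (simp add: cl_rep that)
  ultimately show ?thesis
    unfolding invariant_real_structure_def by (auto simp: carrier_DI rep_L2 s_L2)
qed

end

lemma (in hilbert_field) field_real_structureI: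
  assumes S: "invariant_real_structure DI J S"
  shows "field_real_structure M \<H> \<nu> (\<lambda>f. rep (S (cl f)))"
proof
  have carr: "S F \<in> carrier DI" "S (S F) = F" "hnorm DI (S F) = hnorm DI F" if "F \<in> carrier DI" for F
    using S that by (auto simp: invariant_real_structure_def)
  fix f assume f: "f \<in> L2"
  note F = cl_carrier[OF f]
  show SL2: "rep (S (cl f)) \<in> L2" by (intro rep_L2 carr F)
  show "AE x in M. rep (S (cl (rep (S (cl f))))) x = f x"
    by (simp add: cl_rep carr F rep_cl f)
  show "(LINT x|M. (norm (rep (S (cl f)) x))\<^sup>2) = (LINT x|M. (norm (f x))\<^sup>2)"
    using hnorm_cl[OF SL2] hnorm_cl[OF f] by (simp add: cl_rep carr F)
  fix g assume g: "g \<in> L2"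
  note G = cl_carrier[OF g]
  show "AE x in M. rep (S (cl f)) x = rep (S (cl g)) x" if "AE x in M. f x = g x"
    using cl_cong[OF that] by simp
  fix a b
  have "S (cl (\<lambda>x. a *\<^sub>C f x + b *\<^sub>C g x)) =
      hadd DI (hscale DI (cnj a) (S (cl f))) (hscale DI (cnj b) (S (cl g)))"
    using S F G unfolding combination_cl[OF f g, symmetric] invariant_real_structure_def by blast
  also have "\<dots> = cl (\<lambda>x. cnj a *\<^sub>C rep (S (cl f)) x + cnj b *\<^sub>C rep (S (cl g)) x)"
    using combination_cl[OF rep_L2[OF carr(1)[OF F]] rep_L2[OF carr(1)[OF G]]]
    by (simp add: cl_rep carr F G)
  finally show "AE x in M. rep (S (cl (\<lambda>x. a *\<^sub>C f x + b *\<^sub>C g x))) x =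
      cnj a *\<^sub>C rep (S (cl f)) x + cnj b *\<^sub>C rep (S (cl g)) x"
    using rep_cl[OF L2_combination[OF rep_L2[OF carr(1)[OF F]] rep_L2[OF carr(1)[OF G]]]] by simp
qed

section \<open>Real structures that implement an involution of the base\<close>

text \<open>A real structure that carries multiplication by \<open>1\<^sub>E\<close> to multiplication by
  \<open>1\<^sub>E \<circ> T\<close>, for all \<open>E\<close> in a generating family.\<close>

locale implementing_real_structure = field_real_structure +
  fixes T :: "'a \<Rightarrow> 'a" and G :: "'a set set"
  assumes T_measurable' [measurable]: "T \<in> measurable M M"
    and T_T': "\<And>x. x \<in> space M \<Longrightarrow> T (T x) = x"
    and generating: "sets M = sigma_sets (space M) G"
    and s_generator: "\<And>E f. E \<in> G \<Longrightarrow> f \<in> L2 \<Longrightarrow>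
      AE x in M. s (\<lambda>x. indicator E x *\<^sub>C f x) x = indicator E (T x) *\<^sub>C s f x"
begin

lemma T_space': "x \<in> space M \<Longrightarrow> T x \<in> space M"
  by (rule measurable_space[OF T_measurable'])

lemma s_zero:
  assumes "f \<in> L2" "AE x in M. f x = 0"
  shows "AE x in M. s f x = 0"
proof -
  have "AE x in M. s f x = s (\<lambda>x. 0 *\<^sub>C f x + 0 *\<^sub>C f x) x"
    using assms by (intro s_cong L2_combination) auto
  then show ?thesis
    using s_antilinear[OF assms(1) assms(1), of 0 0] by eventually_elim simp
qed

lemma L2_indicator: "f \<in> L2 \<Longrightarrow> E \<in> sets M \<Longrightarrow> (\<lambda>x. indicator E x *\<^sub>C f x) \<in> L2"
  by (rule L2_mult[where B=1]) (auto simp: indicator_def)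

lemma L2_indicator_T: "f \<in> L2 \<Longrightarrow> E \<in> sets M \<Longrightarrow> (\<lambda>x. indicator E (T x) *\<^sub>C f x) \<in> L2"
  by (rule L2_mult[where B=1]) (auto simp: indicator_def)

lemma s_add:
  assumes "f \<in> L2" "g \<in> L2"
  shows "AE x in M. s (\<lambda>x. f x + g x) x = s f x + s g x"
  using s_antilinear[OF assms, of 1 1] by simp

lemma s_diff:
  assumes "f \<in> L2" "g \<in> L2"
  shows "AE x in M. s (\<lambda>x. f x - g x) x = s f x - s g x"
  using s_antilinear[OF assms, of 1 "-1"] by (simp add: scaleC_minus_one)

text \<open>The sets \<open>E\<close> with \<open>s \<circ> 1\<^sub>E = (1\<^sub>E \<circ> T) \<circ> s\<close> form a \<open>\<sigma>\<close>-algebra; countable unions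
  are reached by continuity of \<open>s\<close> in norm.\<close>

definition transports :: "'a set \<Rightarrow> bool" where
  "transports E \<longleftrightarrow> (\<forall>f\<in>L2. (AE x in M. s (\<lambda>x. indicator E x *\<^sub>C f x) x = indicator E (T x) *\<^sub>C s f x))"

lemma transports_compl:
  assumes "E \<in> sets M" "transports E"
  shows "transports (space M - E)"
  unfolding transports_def
proof
  fix f assume f: "f \<in> L2"
  have "AE x in M. s (\<lambda>x. indicator (space M - E) x *\<^sub>C f x) x = s (\<lambda>x. f x - indicator E x *\<^sub>C f x) x"
    using assms(1) f by (intro s_cong L2_indicator L2_diff AE_I2) (auto simp: indicator_def)
  moreover have "AE x in M. s (\<lambda>x. f x - indicator E x *\<^sub>C f x) x =
      s f x - s (\<lambda>x. indicator E x *\<^sub>C f x) x"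
    using f assms(1) by (intro s_diff L2_indicator)
  moreover have "AE x in M. s (\<lambda>x. indicator E x *\<^sub>C f x) x = indicator E (T x) *\<^sub>C s f x"
    using assms(2) f by (simp add: transports_def)
  ultimately show "AE x in M. s (\<lambda>x. indicator (space M - E) x *\<^sub>C f x) x =
      indicator (space M - E) (T x) *\<^sub>C s f x"
    using AE_space by eventually_elim (simp add: indicator_def T_space')
qed

lemma transports_Un:
  assumes "E \<in> sets M" "transports E" "F \<in> sets M" "transports F"
  shows "transports (E \<union> F)"
  unfolding transports_def
proof
  fix f assume f: "f \<in> L2"
  define g where "g x = f x - indicator E x *\<^sub>C f x" for x
  have g: "g \<in> L2"
    unfolding g_def using assms(1) f by (intro L2_diff L2_indicator)
  have "AE x in M. s (\<lambda>x. indicator (E \<union> F) x *\<^sub>C f x) x =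
      s (\<lambda>x. indicator E x *\<^sub>C f x + indicator F x *\<^sub>C g x) x"
    by (intro s_cong L2_add L2_indicator AE_I2 f g sets.Un assms) (auto simp: indicator_def g_def)
  moreover have "AE x in M. s (\<lambda>x. indicator E x *\<^sub>C f x + indicator F x *\<^sub>C g x) x =
      s (\<lambda>x. indicator E x *\<^sub>C f x) x + s (\<lambda>x. indicator F x *\<^sub>C g x) x"
    using assms f g by (intro s_add L2_indicator)
  moreover have "AE x in M. s g x = s f x - s (\<lambda>x. indicator E x *\<^sub>C f x) x"
    unfolding g_def using f assms(1) by (intro s_diff L2_indicator)
  moreover have "AE x in M. s (\<lambda>x. indicator E x *\<^sub>C f x) x = indicator E (T x) *\<^sub>C s f x"
    using assms(2) f by (simp add: transports_def)
  moreover have "AE x in M. s (\<lambda>x. indicator F x *\<^sub>C g x) x = indicator F (T x) *\<^sub>C s g x"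
    using assms(4) g by (simp add: transports_def)
  ultimately show "AE x in M. s (\<lambda>x. indicator (E \<union> F) x *\<^sub>C f x) x =
      indicator (E \<union> F) (T x) *\<^sub>C s f x"
    by eventually_elim (simp add: indicator_def)
qed

lemma transports_empty: "transports {}"
  unfolding transports_def
proof
  fix f assume f: "f \<in> L2"
  show "AE x in M. s (\<lambda>x. indicator {} x *\<^sub>C f x) x = indicator {} (T x) *\<^sub>C s f x"
    using s_zero[OF L2_indicator[OF f sets.empty_sets]] by simp
qed

lemma transports_UN:
  fixes A :: "nat \<Rightarrow> 'a set"
  assumes A: "\<And>i. A i \<in> sets M" and resp: "\<And>i. transports (A i)"
  shows "transports (\<Union>i. A i)"
  unfolding transports_def
proof
  fix f assume f: "f \<in> L2"
  note sf = s_L2[OF f]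
  note [measurable] = L2_measurable[OF f] L2_measurable[OF sf] A
  define B where "B n = (\<Union>i<n. A i)" for n :: nat
  define C where "C n = (\<Union>i. A i) - B n" for n
  have B [measurable]: "B n \<in> sets M" for n unfolding B_def by measurable
  have C [measurable]: "C n \<in> sets M" for n unfolding C_def by measurable
  have U [measurable]: "(\<Union>i. A i) \<in> sets M" by measurable
  have "transports (B n)" for n
  proof (induction n)
    case 0 then show ?case by (simp add: B_def transports_empty)
  next
    case (Suc n)
    have "B (Suc n) = B n \<union> A n" by (auto simp: B_def lessThan_Suc)
    then show ?case using Suc transports_Un A resp B by simp
  qed
  then have sB: "AE x in M. s (\<lambda>x. indicator (B n) x *\<^sub>C f x) x = indicator (B n) (T x) *\<^sub>C s f x" for n
    using f by (simp add: transports_def)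
  define u where "u x = s (\<lambda>x. indicator (\<Union>i. A i) x *\<^sub>C f x) x - indicator (\<Union>i. A i) (T x) *\<^sub>C s f x" for x
  have u: "u \<in> L2"
    unfolding u_def by (intro L2_diff s_L2 L2_indicator L2_indicator_T f sf U)
  define bound where "bound n = 2 * (LINT x|M. indicator (C n) x * (norm (f x))\<^sup>2)
      + 2 * (LINT x|M. indicator (C n) (T x) * (norm (s f x))\<^sup>2)" for n
  have le: "(LINT x|M. (norm (u x))\<^sup>2) \<le> bound n" for n
  proof -
    let ?v = "s (\<lambda>x. indicator (C n) x *\<^sub>C f x)" and ?w = "\<lambda>x. indicator (C n) (T x) *\<^sub>C s f x"
    have v: "?v \<in> L2" by (intro s_L2 L2_indicator f C)
    have w: "?w \<in> L2" by (intro L2_indicator_T sf C)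
    have CB: "indicator (\<Union>i. A i) x = indicator (B n) x + (indicator (C n) x :: complex)" for x
      by (auto simp: indicator_def C_def B_def)
    have "AE x in M. s (\<lambda>x. indicator (\<Union>i. A i) x *\<^sub>C f x) x =
        s (\<lambda>x. indicator (B n) x *\<^sub>C f x) x + ?v x"
      unfolding CB scaleC_add_left by (intro s_add L2_indicator f B C)
    then have "AE x in M. u x = ?v x - ?w x"
      using sB[of n] by eventually_elim (simp add: u_def CB scaleC_add_left)
    then have "AE x in M. (norm (u x))\<^sup>2 \<le> 2 * (norm (?v x))\<^sup>2 + 2 * (norm (?w x))\<^sup>2"
    proof eventually_elim
      case (elim x)
      then show ?case using norm_add_square_le[of "?v x" "- ?w x"] by simp
    qed
    then have "(LINT x|M. (norm (u x))\<^sup>2) \<le> (LINT x|M. 2 * (norm (?v x))\<^sup>2 + 2 * (norm (?w x))\<^sup>2)"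
      using L2_integrable[OF u] L2_integrable[OF v] L2_integrable[OF w]
      by (intro integral_mono_AE) auto
    also have "\<dots> = 2 * (LINT x|M. (norm (?v x))\<^sup>2) + 2 * (LINT x|M. (norm (?w x))\<^sup>2)"
      using L2_integrable[OF v] L2_integrable[OF w] by simp
    also have "(LINT x|M. (norm (?v x))\<^sup>2) = (LINT x|M. (norm (indicator (C n) x *\<^sub>C f x))\<^sup>2)"
      by (intro s_norm L2_indicator f C)
    also have "\<dots> = (LINT x|M. indicator (C n) x * (norm (f x))\<^sup>2)"
      by (intro Bochner_Integration.integral_cong) (auto simp: indicator_def)
    also have "(LINT x|M. (norm (?w x))\<^sup>2) = (LINT x|M. indicator (C n) (T x) * (norm (s f x))\<^sup>2)"
      by (intro Bochner_Integration.integral_cong) (auto simp: indicator_def)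
    finally show ?thesis by (simp add: bound_def)
  qed
  have ev: "(\<lambda>n. indicator (C n) x * c) \<longlonglongrightarrow> 0" for x and c :: real
  proof (rule tendsto_eventually)
    show "\<forall>\<^sub>F n in sequentially. indicator (C n) x * c = 0"
    proof (cases "\<exists>i. x \<in> A i")
      case True
      then obtain i where "x \<in> A i" ..
      then have "x \<notin> C n" if "n > i" for n using that by (auto simp: C_def B_def)
      then show ?thesis
        by (intro eventually_mono[OF eventually_gt_at_top[of i]]) (simp add: indicator_def)
    qed (simp add: C_def indicator_def)
  qed
  have "(\<lambda>n. LINT x|M. indicator (C n) x * (norm (f x))\<^sup>2) \<longlonglongrightarrow> (LINT x|M. 0)"
    by (rule integral_dominated_convergence[OF _ _ L2_integrable[OF f]])
       (auto intro!: ev AE_I2 split: split_indicator)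
  moreover have "(\<lambda>n. LINT x|M. indicator (C n) (T x) * (norm (s f x))\<^sup>2) \<longlonglongrightarrow> (LINT x|M. 0)"
    by (rule integral_dominated_convergence[OF _ _ L2_integrable[OF sf]])
       (auto intro!: ev AE_I2 split: split_indicator)
  ultimately have "bound \<longlonglongrightarrow> 2 * 0 + 2 * 0"
    unfolding bound_def by (intro tendsto_intros) simp_all
  then have "(LINT x|M. (norm (u x))\<^sup>2) \<le> 0"
    using le by (intro LIMSEQ_le_const[of bound]) auto
  then have "AE x in M. u x = 0" by (rule L2_AE_zero[OF u])
  then show "AE x in M. s (\<lambda>x. indicator (\<Union>i. A i) x *\<^sub>C f x) x = indicator (\<Union>i. A i) (T x) *\<^sub>C s f x"
    by (simp add: u_def)
qed

lemma transports_sets: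
  assumes "E \<in> sets M"
  shows "transports E"
proof -
  have "E \<in> sigma_sets (space M) G" using assms generating by simp
  then show ?thesis
  proof induction
    case (Basic E)
    then show ?case using s_generator by (simp add: transports_def)
  next
    case Empty
    show ?case by (rule transports_empty)
  next
    case (Compl E)
    then show ?case using generating by (intro transports_compl) auto
  next
    case (Union A)
    then show ?case using generating by (intro transports_UN) auto
  qed
qed

lemma s_indicator:
  "f \<in> L2 \<Longrightarrow> E \<in> sets M \<Longrightarrow>
    AE x in M. s (\<lambda>x. indicator E x *\<^sub>C f x) x = indicator E (T x) *\<^sub>C s f x"
  using transports_sets by (simp add: transports_def)

text \<open>If \<open>E\<close> is null, then \<open>1\<^sub>E \<circ> T\<close> annihilates the range of \<open>s\<close>, which contains a field without
  zeros.\<close>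

lemma absolutely_continuous_T: "absolutely_continuous M (distr M M T)"
  unfolding absolutely_continuous_def
proof
  fix E assume E: "E \<in> null_sets M"
  then have [measurable]: "E \<in> sets M" by auto
  let ?f = "s (basis_field 0)"
  have f: "?f \<in> L2" by (intro s_L2 basis_field_L2)
  have "AE x in M. s (\<lambda>x. indicator E x *\<^sub>C ?f x) x = 0"
    using AE_not_in[OF E] by (intro s_zero L2_indicator f) auto
  then have "AE x in M. T x \<notin> E"
    using s_indicator[OF f \<open>E \<in> sets M\<close>] s_s[OF basis_field_L2[of 0]] AE_space
  proof eventually_elim
    case (elim x)
    then show ?case using basis_field_0_nonzero[of x] by (auto simp: indicator_def)
  qed
  then have "emeasure M (T -` E \<inter> space M) = 0"
    by (subst (asm) AE_iff_measurable[OF _ refl]) (auto simp: vimage_def Int_def conj_commute)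
  then show "E \<in> null_sets (distr M M T)"
    by (intro null_setsI) (auto simp: emeasure_distr)
qed

sublocale nonsingular_involution M T
  by standard (auto intro: T_T' absolutely_continuous_T)

text \<open>Both sides have the same integral over every measurable set \<open>A\<close>: apply norm preservation to \<open>f\<close>
  cut off to the preimage of \<open>A\<close>.\<close>

lemma norm_s:
  assumes f: "f \<in> L2"
  shows "AE x in M. (norm (s f x))\<^sup>2 = jac x * (norm (f (T x)))\<^sup>2"
proof -
  note sf = s_L2[OF f]
  note [measurable] = L2_measurable[OF f] L2_measurable[OF sf]
  have "AE x in M. ennreal ((norm (s f x))\<^sup>2) = ennreal (jac x * (norm (f (T x)))\<^sup>2)"
  proof (rule density_unique)
    show "density M (\<lambda>x. ennreal ((norm (s f x))\<^sup>2)) = density M (\<lambda>x. ennreal (jac x * (norm (f (T x)))\<^sup>2))"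
    proof (rule measure_eqI)
      fix A assume "A \<in> sets (density M (\<lambda>x. ennreal ((norm (s f x))\<^sup>2)))"
      then have [measurable]: "A \<in> sets M" by simp
      define B where "B = T -` A \<inter> space M"
      have B [measurable]: "B \<in> sets M" unfolding B_def by measurable
      define g where "g x = indicator B x *\<^sub>C f x" for x
      have g: "g \<in> L2" unfolding g_def by (intro L2_indicator f B)
      note [measurable] = L2_measurable[OF g] L2_measurable[OF s_L2[OF g]]
      have sg: "AE x in M. s g x = indicator A x *\<^sub>C s f x"
        using s_indicator[OF f B] AE_space
        by eventually_elim (simp add: g_def[abs_def] B_def indicator_def T_T' T_space')
      have "(\<integral>\<^sup>+x. ennreal ((norm (s f x))\<^sup>2) * indicator A x \<partial>M) = (\<integral>\<^sup>+x. ennreal ((norm (s g x))\<^sup>2) \<partial>M)"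
        by (rule nn_integral_cong_AE) (use sg in eventually_elim, simp add: indicator_def)
      also have "\<dots> = ennreal (LINT x|M. (norm (s g x))\<^sup>2)"
        by (rule nn_integral_eq_integral[OF L2_integrable[OF s_L2[OF g]]]) simp
      also have "\<dots> = ennreal (LINT x|M. (norm (g x))\<^sup>2)"
        by (simp add: s_norm g)
      also have "\<dots> = (\<integral>\<^sup>+x. ennreal ((norm (g x))\<^sup>2) \<partial>M)"
        by (rule nn_integral_eq_integral[OF L2_integrable[OF g], symmetric]) simp
      also have "\<dots> = (\<integral>\<^sup>+x. ennreal (jac x) * ennreal ((norm (g (T x)))\<^sup>2) \<partial>M)"
        by (rule nn_integral_T[symmetric]) measurable
      also have "\<dots> = (\<integral>\<^sup>+x. ennreal (jac x * (norm (f (T x)))\<^sup>2) * indicator A x \<partial>M)"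
        by (intro nn_integral_cong)
           (auto simp: g_def B_def indicator_def T_T' T_space' ennreal_mult')
      finally show "emeasure (density M (\<lambda>x. ennreal ((norm (s f x))\<^sup>2))) A =
          emeasure (density M (\<lambda>x. ennreal (jac x * (norm (f (T x)))\<^sup>2))) A"
        by (simp add: emeasure_density)
    qed simp
  qed measurable
  then show ?thesis by eventually_elim simp
qed

text \<open>Polarisation; the imaginary part is the real part for \<open>\<i> f\<close>.\<close>

lemma cinner_s:
  assumes f: "f \<in> L2" and g: "g \<in> L2"
  shows "AE x in M. cinner (s f x) (s g x) = complex_of_real (jac x) * cnj (cinner (f (T x)) (g (T x)))"
proof -
  have re: "AE x in M. Re (cinner (s f x) (s g x)) = jac x * Re (cinner (f (T x)) (g (T x)))"
    if f: "f \<in> L2" for f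
    using norm_s[OF f] norm_s[OF g] norm_s[OF L2_add[OF f g]] s_add[OF f g]
  proof eventually_elim
    case (elim x)
    then show ?case by (simp add: norm_add_square algebra_simps)
  qed
  have if_: "(\<lambda>x. \<i> *\<^sub>C f x) \<in> L2" by (rule L2_scale[OF f])
  have "AE x in M. s (\<lambda>x. \<i> *\<^sub>C f x) x = (- \<i>) *\<^sub>C s f x"
    using s_antilinear[OF f f, of \<i> 0] by simp
  then have "AE x in M. Im (cinner (s f x) (s g x)) = - (jac x * Im (cinner (f (T x)) (g (T x))))"
    using re[OF if_] by eventually_elim (simp add: cinner_scaleC_left)
  then show ?thesis
    using re[OF f] by eventually_elim (simp add: complex_eq_iff)
qed

text \<open>The normalised images of the basis fields are orthonormal at almost every point.\<close>

definition frame :: "nat \<Rightarrow> 'a \<Rightarrow> 'b" where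
  "frame i x = inverse (sqrt (jac x) * weight (T x)) *\<^sub>R s (basis_field i) x"

lemma frame_measurable [measurable]: "frame i \<in> borel_measurable M"
  using L2_measurable[OF s_L2[OF basis_field_L2[of i]]] unfolding frame_def by measurable

lemma cinner_frame:
  assumes f: "f \<in> L2"
  shows "AE x in M. cinner (s f x) (frame i x) =
    complex_of_real (sqrt (jac x)) * cnj (cinner (f (T x)) (basis (\<nu> (T x)) i))"
  using cinner_s[OF f basis_field_L2[of i]] jac_pos AE_space
proof eventually_elim
  case (elim x)
  have "weight (T x) > 0" using weight_pos[OF T_space'] elim by simp
  moreover have "jac x = sqrt (jac x) * sqrt (jac x)" using elim by simp
  ultimately show ?case
    using elim by (simp add: frame_def cinner_scaleR_right basis_field_def field_simps flip: of_real_mult)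
qed

lemma frame_orthonormal:
  "AE x in M. orthonormal_on {i. enat i < \<nu> (T x)} (\<lambda>i. frame i x)"
proof -
  have "AE x in M. \<forall>i j. cinner (frame i x) (frame j x) = of_bool (i = j \<and> enat i < \<nu> (T x))"
    unfolding AE_all_countable
  proof (intro allI)
    fix i j
    show "AE x in M. cinner (frame i x) (frame j x) = of_bool (i = j \<and> enat i < \<nu> (T x))"
      using cinner_frame[OF basis_field_L2[of i], of j] jac_pos AE_space
    proof eventually_elim
      case (elim x)
      define t where "t = sqrt (jac x) * weight (T x)"
      have t: "t \<noteq> 0" using weight_pos[OF T_space'[OF elim(3)]] elim(2) by (simp add: t_def)
      have "cinner (basis (\<nu> (T x)) i) (basis (\<nu> (T x)) j) = of_bool (i = j \<and> enat i < \<nu> (T x))"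
        using basis_orthonormal[OF dim_pos[OF T_space']] elim by (simp add: orthonormal_on_def)
      then have "cinner (s (basis_field i) x) (frame j x) =
          complex_of_real t * of_bool (i = j \<and> enat i < \<nu> (T x))"
        using elim(1) by (simp add: basis_field_def cinner_scaleR_left t_def)
      then show ?case
        using t unfolding frame_def[of i] t_def[symmetric] by (simp add: cinner_scaleR_left)
    qed
  qed
  then show ?thesis by (simp add: orthonormal_on_def)
qed

lemma frame_mem_fibre: "x \<in> space M \<Longrightarrow> frame i x \<in> \<H> (\<nu> x)"
  unfolding frame_def
  by (metis scaleC_of_real scaleC_mem_fibre dim_pos L2_fibre s_L2 basis_field_L2)

text \<open>The frame at \<open>x\<close> consists of \<open>\<nu> (T x)\<close> orthonormal vectors in a space of dimension \<open>\<nu> x\<close>.\<close>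

lemma dim_T: "AE x in M. \<nu> x = \<nu> (T x)"
proof -
  have le: "AE x in M. \<nu> (T x) \<le> \<nu> x"
    using frame_orthonormal AE_space
  proof eventually_elim
    case (elim x)
    show ?case
      by (rule orthonormal_dim_le[OF basis_orthonormal elim(1)])
         (use elim dim_pos frame_mem_fibre in \<open>auto simp flip: fibre_eq_span\<close>)
  qed
  show ?thesis
    using le AE_T[OF le] AE_space by eventually_elim (simp add: T_T' order_antisym)
qed

text \<open>The fibre operator of \<open>s\<close> at \<open>x\<close> carries the basis of the fibre to the frame. It should start
  from the fibre at \<open>T x\<close>, which is almost everywhere the same space with the same basis.\<close>

definition fibre_op :: "'a \<Rightarrow> 'b \<Rightarrow> 'b" where
  "fibre_op x = antilinear_ext (basis (\<nu> x)) (\<lambda>i. frame i x)"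

lemma fibre_op_measurable: "measurable_operator_field \<H> M \<nu> fibre_op"
  unfolding measurable_operator_field_def
proof
  fix f assume "f \<in> measurable_fields \<H> M \<nu>"
  then have [measurable]: "f \<in> borel_measurable M" by (simp add: measurable_fields_def)
  have cnj: "cnj \<in> borel_measurable borel"
    by (intro borel_measurable_continuous_onI continuous_intros)
  have [measurable]: "(\<lambda>x. cnj (cinner (f x) (basis (\<nu> x) i))) \<in> borel_measurable M" for i
    by (rule measurable_compose[OF _ cnj]) measurable
  show "(\<lambda>x. fibre_op x (f x)) \<in> borel_measurable M"
    unfolding fibre_op_def antilinear_ext_def by measurable
qed

lemma AE_frame:
  "AE x in M. x \<in> space M \<and> \<nu> (T x) = \<nu> x \<and> orthonormal_on {i. enat i < \<nu> x} (basis (\<nu> x)) \<and>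
    orthonormal_on {i. enat i < \<nu> x} (\<lambda>i. frame i x) \<and> \<H> (\<nu> x) = closure (cspan (range (basis (\<nu> x))))"
  using frame_orthonormal dim_T AE_space
  by eventually_elim (simp add: basis_orthonormal fibre_eq_span dim_pos T_space')

lemma fibre_op_antilinear_isometry:
  "AE x in M. antilinear_isometry_between (\<H> (\<nu> x)) (\<H> (\<nu> (T x))) (fibre_op x)"
  using AE_frame
proof eventually_elim
  case (elim x)
  have "closure (cspan (range (\<lambda>i. frame i x))) \<subseteq> \<H> (\<nu> x)"
    using elim frame_mem_fibre by (intro csubspace_closed_spanI csubspace_fibre closed_fibre) (auto intro: dim_pos)
  then show ?case
    using elim antilinear_ext_mem[of "{i. enat i < \<nu> x}" "basis (\<nu> x)" "\<lambda>i. frame i x"]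
      antilinear_ext_antilinear[of "{i. enat i < \<nu> x}" "basis (\<nu> x)" "\<lambda>i. frame i x"]
      norm_antilinear_ext[of "{i. enat i < \<nu> x}" "basis (\<nu> x)" "\<lambda>i. frame i x"]
    by (auto simp: antilinear_isometry_between_def fibre_op_def)
qed

lemma s_eq_fibre_op:
  assumes f: "f \<in> L2"
  shows "AE x in M. s f x = sqrt (jac x) *\<^sub>R fibre_op x (f (T x))"
proof -
  have "AE x in M. \<forall>i. cinner (s f x) (frame i x) =
      complex_of_real (sqrt (jac x)) * cnj (cinner (f (T x)) (basis (\<nu> (T x)) i))"
    unfolding AE_all_countable using cinner_frame[OF f] by simp
  then show ?thesis
    using AE_frame norm_s[OF f]
  proof eventually_elim
    case (elim x)
    have "f (T x) \<in> \<H> (\<nu> (T x))" by (rule L2_fibre[OF f T_space']) (use elim in simp)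
    moreover have "norm (s f x) = sqrt (jac x) * norm (f (T x))"
      by (rule power2_eq_imp_eq) (use elim in \<open>simp_all add: power_mult_distrib\<close>)
    ultimately show ?case
      unfolding fibre_op_def
      by (intro antilinear_ext_eqI[where A="{i. enat i < \<nu> x}"]) (use elim in auto)
  qed
qed

text \<open>On the basis fields this is \<open>s \<circ> s = id\<close> read off at a point, as the two densities cancel.\<close>

lemma fibre_op_involution: "AE x in M. \<forall>v \<in> \<H> (\<nu> x). fibre_op x (fibre_op (T x) v) = v"
proof -
  have "AE x in M. \<forall>j. fibre_op x (fibre_op (T x) (basis (\<nu> x) j)) = basis (\<nu> x) j"
    unfolding AE_all_countable
  proof
    fix j
    show "AE x in M. fibre_op x (fibre_op (T x) (basis (\<nu> x) j)) = basis (\<nu> x) j"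
      using s_s[OF basis_field_L2[of j]] s_eq_fibre_op[OF s_L2[OF basis_field_L2[of j]]]
        AE_T[OF s_eq_fibre_op[OF basis_field_L2[of j]]] jac_T AE_frame
        fibre_op_antilinear_isometry AE_T[OF fibre_op_antilinear_isometry]
    proof eventually_elim
      case (elim x)
      let ?b = "basis (\<nu> x) j"
      have x: "x \<in> space M" "\<nu> (T x) = \<nu> x" using elim by auto
      have b: "?b \<in> \<H> (\<nu> x)" using basis_mem dim_pos x by simp
      have r: "antilinear_isometry_between (\<H> (\<nu> x)) (\<H> (\<nu> x)) (fibre_op x)"
        "antilinear_isometry_between (\<H> (\<nu> x)) (\<H> (\<nu> x)) (fibre_op (T x))"
        using elim x by (auto simp: T_T')
      have rb: "fibre_op (T x) ?b \<in> \<H> (\<nu> x)"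
        by (rule antilinear_isometry_mem[OF r(2) b])
      have "s (basis_field j) (T x) = (sqrt (jac (T x)) * weight x) *\<^sub>R fibre_op (T x) ?b"
        using elim x b by (simp add: T_T' basis_field_def antilinear_isometry_scaleR[OF r(2)])
      then have "basis_field j x =
          (sqrt (jac x) * (sqrt (jac (T x)) * weight x)) *\<^sub>R fibre_op x (fibre_op (T x) ?b)"
        using elim rb by (simp add: antilinear_isometry_scaleR[OF r(1)])
      also have "sqrt (jac x) * (sqrt (jac (T x)) * weight x) = weight x"
        using elim by (simp flip: real_sqrt_mult mult.assoc)
      finally show ?case
        using weight_pos[OF x(1)] by (simp add: basis_field_def)
    qed
  qed
  then show ?thesis
    using AE_frame fibre_op_antilinear_isometry AE_T[OF fibre_op_antilinear_isometry]
  proof eventually_elim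
    case (elim x)
    have r: "antilinear_isometry_between (\<H> (\<nu> x)) (\<H> (\<nu> x)) (fibre_op x)"
      "antilinear_isometry_between (\<H> (\<nu> x)) (\<H> (\<nu> x)) (fibre_op (T x))"
      using elim by (auto simp: T_T')
    have mem: "fibre_op (T x) v \<in> \<H> (\<nu> x)" if "v \<in> \<H> (\<nu> x)" for v
      using that by (rule antilinear_isometry_mem[OF r(2)])
    show ?case
    proof
      fix v assume v: "v \<in> \<H> (\<nu> x)"
      have H: "\<H> (\<nu> x) = closure (cspan (range (basis (\<nu> x))))" using elim by simp
      show "fibre_op x (fibre_op (T x) v) = v"
      proof (rule semilinear_isometry_eqI[where \<phi>="\<lambda>a. a" and B="range (basis (\<nu> x))" and
            T="\<lambda>v. fibre_op x (fibre_op (T x) v)" and T'="\<lambda>v. v", folded H])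
        show "fibre_op x (fibre_op (T x) (a *\<^sub>C v + b *\<^sub>C w)) =
            a *\<^sub>C fibre_op x (fibre_op (T x) v) + b *\<^sub>C fibre_op x (fibre_op (T x) w)"
          if "v \<in> \<H> (\<nu> x)" "w \<in> \<H> (\<nu> x)" for a b v w
          using that mem
          by (simp add: antilinear_isometry_combination[OF r(1)] antilinear_isometry_combination[OF r(2)])
        show "norm (fibre_op x (fibre_op (T x) v)) = norm v" if "v \<in> \<H> (\<nu> x)" for v
          using that mem by (simp add: antilinear_isometry_norm[OF r(1)] antilinear_isometry_norm[OF r(2)])
      qed (use elim v in auto)
    qed
  qed
qed

end

text \<open>Conversely, antilinear isometries of the fibres over a nonsingular involution define a real
  structure.\<close>

locale fibrewise_real_structure =
  hilbert_field M \<H> \<nu> + nonsingular_involution M T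
  for M :: "'x measure" and \<H> :: "enat \<Rightarrow> 'v::{complex_hilbert, second_countable_topology} set"
    and \<nu> T +
  fixes r :: "'x \<Rightarrow> 'v \<Rightarrow> 'v"
  assumes dim_T: "AE x in M. \<nu> x = \<nu> (T x)"
    and r_measurable: "measurable_operator_field \<H> M \<nu> r"
    and r_isometry: "AE x in M. antilinear_isometry_between (\<H> (\<nu> x)) (\<H> (\<nu> (T x))) (r x)"
    and r_r: "AE x in M. \<forall>v \<in> \<H> (\<nu> x). r x (r (T x) v) = v"
begin

text \<open>The field \<open>x \<mapsto> \<surd>(jac x) \<cdot> r x (f (T x))\<close>, modified on a null set so that it is measurable with
  values in the fibres at every point.\<close>

definition global_op :: "('x \<Rightarrow> 'v) \<Rightarrow> 'x \<Rightarrow> 'v" where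
  "global_op f = (SOME g. g \<in> L2 \<and> (AE x in M. g x = sqrt (jac x) *\<^sub>R r x (f (T x))))"

lemma r_T: "AE x in M. antilinear_isometry_between (\<H> (\<nu> x)) (\<H> (\<nu> x)) (r x) \<and>
    antilinear_isometry_between (\<H> (\<nu> x)) (\<H> (\<nu> x)) (r (T x)) \<and> \<nu> (T x) = \<nu> x \<and> x \<in> space M"
  using r_isometry AE_T[OF r_isometry] dim_T AE_space by eventually_elim (simp add: T_T)

lemma
  assumes f: "f \<in> L2"
  shows global_op_L2: "global_op f \<in> L2"
    and global_op: "AE x in M. global_op f x = sqrt (jac x) *\<^sub>R r x (f (T x))"
proof -
  note [measurable] = L2_measurable[OF f]
  have mem: "AE x in M. f (T x) \<in> \<H> (\<nu> x)"
    using r_T by eventually_elim (metis L2_fibre[OF f] T_space)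
  obtain g where g: "g \<in> measurable_fields \<H> M \<nu>" "AE x in M. g x = f (T x)"
    using measurable_fields_modify[OF _ mem] by auto
  have rg [measurable]: "(\<lambda>x. r x (g x)) \<in> borel_measurable M"
    using r_measurable g(1) by (simp add: measurable_operator_field_def)
  let ?h = "\<lambda>x. sqrt (jac x) *\<^sub>R r x (g x)"
  have norm: "AE x in M. jac x * (norm (f (T x)))\<^sup>2 = (norm (?h x))\<^sup>2"
    using g(2) r_T mem
    by eventually_elim (simp add: antilinear_isometry_between_def power_mult_distrib)
  have "integrable M (\<lambda>x. jac x * (norm (f (T x)))\<^sup>2)"
    using L2_integrable[OF f] by (rule integrable_T(1)) simp
  then have "integrable M (\<lambda>x. (norm (?h x))\<^sup>2)"
    by (rule integrable_cong_AE_imp) (use norm in auto)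
  moreover have "AE x in M. ?h x \<in> \<H> (\<nu> x)"
    using g(2) r_T mem
  proof eventually_elim
    case (elim x)
    then have "r x (g x) \<in> \<H> (\<nu> x)" using antilinear_isometry_mem by metis
    then show ?case
      using elim scaleC_mem_fibre[OF dim_pos, of x _ "complex_of_real (sqrt (jac x))"]
      by (simp add: scaleC_of_real)
  qed
  ultimately obtain h where h: "h \<in> L2" "AE x in M. h x = ?h x"
    using L2_modify[of ?h] by auto
  have "AE x in M. h x = sqrt (jac x) *\<^sub>R r x (f (T x))"
    using h(2) g(2) by eventually_elim simp
  with h(1) have "\<exists>h. h \<in> L2 \<and> (AE x in M. h x = sqrt (jac x) *\<^sub>R r x (f (T x)))" by blast
  from someI_ex[OF this] show "global_op f \<in> L2"
    "AE x in M. global_op f x = sqrt (jac x) *\<^sub>R r x (f (T x))"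
    by (simp_all add: global_op_def)
qed

lemma field_real_structure_global_op: "field_real_structure M \<H> \<nu> global_op"
proof
  fix f assume f: "f \<in> L2"
  show "global_op f \<in> L2" by (rule global_op_L2[OF f])
  show "AE x in M. global_op (global_op f) x = f x"
    using global_op[OF global_op_L2[OF f]] AE_T[OF global_op[OF f]] r_T r_r jac_T
  proof eventually_elim
    case (elim x)
    have fx: "f x \<in> \<H> (\<nu> x)" using L2_fibre[OF f] elim by simp
    have ri: "antilinear_isometry_between (\<H> (\<nu> x)) (\<H> (\<nu> x)) (r x)" using elim by simp
    have "r (T x) (f x) \<in> \<H> (\<nu> x)" using elim fx antilinear_isometry_mem by blast
    then have "global_op (global_op f) x = (sqrt (jac x) * sqrt (jac (T x))) *\<^sub>R r x (r (T x) (f x))"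
      using elim by (simp add: T_T antilinear_isometry_scaleR[OF ri])
    then show ?case using elim fx by (simp flip: real_sqrt_mult)
  qed
  note [measurable] = L2_measurable[OF f] L2_measurable[OF global_op_L2[OF f]]
  have "(LINT x|M. (norm (global_op f x))\<^sup>2) = (LINT x|M. jac x * (norm (f (T x)))\<^sup>2)"
  proof (rule integral_cong_AE)
    show "AE x in M. (norm (global_op f x))\<^sup>2 = jac x * (norm (f (T x)))\<^sup>2"
      using global_op[OF f] r_T
    proof eventually_elim
      case (elim x)
      then have "f (T x) \<in> \<H> (\<nu> x)" using L2_fibre[OF f T_space] by metis
      then show ?case using elim by (simp add: antilinear_isometry_between_def power_mult_distrib)
    qed
  qed measurable
  also have "\<dots> = (LINT x|M. (norm (f x))\<^sup>2)"
    using L2_integrable[OF f] by (rule integrable_T(2)) simp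
  finally show "(LINT x|M. (norm (global_op f x))\<^sup>2) = (LINT x|M. (norm (f x))\<^sup>2)" .
  fix g assume g: "g \<in> L2"
  show "AE x in M. global_op f x = global_op g x" if "AE x in M. f x = g x"
    using AE_T[OF that] global_op[OF f] global_op[OF g] by eventually_elim simp
  fix a b
  show "AE x in M. global_op (\<lambda>x. a *\<^sub>C f x + b *\<^sub>C g x) x =
      cnj a *\<^sub>C global_op f x + cnj b *\<^sub>C global_op g x"
    using global_op[OF L2_combination[OF f g, of a b]] global_op[OF f] global_op[OF g] r_T
  proof eventually_elim
    case (elim x)
    then have "f (T x) \<in> \<H> (\<nu> x)" "g (T x) \<in> \<H> (\<nu> x)"
      using L2_fibre[OF f T_space] L2_fibre[OF g T_space] by metis+
    then show ?case
      using elim by (simp add: antilinear_isometry_between_def scaleR_add_right scaleC_scaleR)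
  qed
qed

end

section \<open>G\<aring>rding--Wightman modules\<close>

text \<open>The data of a module, with the Clifford action \<open>J\<close> on its direct integral.\<close>

locale GW_module =
  fixes I :: "nat set"
    and \<sigma> :: "'z::{real_inner, complete_space, second_countable_topology} \<Rightarrow> 'z"
    and z :: "nat \<Rightarrow> 'z"
    and \<H> :: "enat \<Rightarrow> 'v::{complex_hilbert, second_countable_topology} set"
    and \<mu> :: "(nat \<Rightarrow> bit) measure"
    and \<nu> :: "(nat \<Rightarrow> bit) \<Rightarrow> enat"
    and c :: "nat \<Rightarrow> (nat \<Rightarrow> bit) \<Rightarrow> 'v \<Rightarrow> 'v"
    and J :: "'z \<Rightarrow> ((nat \<Rightarrow> bit) \<Rightarrow> 'v) set \<Rightarrow> ((nat \<Rightarrow> bit) \<Rightarrow> 'v) set"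
  assumes index: "index_set I"
    and ubasis: "unitary_basis I \<sigma> z"
    and hdim: "\<And>n. 1 \<le> n \<Longrightarrow> has_hilbert_dim (\<H> n) n"
    and triple: "GW_triple I \<H> \<mu> \<nu> c"
    and action: "GW_action I \<sigma> z \<H> \<mu> \<nu> c J"
begin

text \<open>The reflection \<open>x \<mapsto> \<one> - x\<close>.\<close>

abbreviation mirror :: "(nat \<Rightarrow> bit) \<Rightarrow> nat \<Rightarrow> bit" where
  "mirror x \<equiv> ones I - x"

lemma sets_mu: "sets \<mu> = sigma_sets (bitseqs I) ((\<lambda>k. {x \<in> bitseqs I. x k = 1}) ` I)"
proof -
  have "sets \<mu> = sets (bitseq_space I)" using triple by (simp add: GW_triple_def)
  also have "\<dots> = sigma_sets (bitseqs I) ((\<lambda>k. {x \<in> bitseqs I. x k = 1}) ` I)"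
    unfolding bitseq_space_def by (rule sets_measure_of) auto
  finally show ?thesis .
qed

lemma space_mu: "space \<mu> = bitseqs I"
proof -
  have "space \<mu> = space (bitseq_space I)"
    using triple by (intro sets_eq_imp_space_eq) (simp add: GW_triple_def)
  also have "\<dots> = bitseqs I" unfolding bitseq_space_def by (rule space_measure_of) auto
  finally show ?thesis .
qed

lemma coordinate_set: "k \<in> I \<Longrightarrow> {x \<in> bitseqs I. x k = 1} \<in> sets \<mu>"
  by (auto simp: sets_mu)

text \<open>A map that adds a constant to each coordinate is measurable.\<close>

lemma measurable_bitseqsI:
  assumes space: "\<And>x. x \<in> bitseqs I \<Longrightarrow> F x \<in> bitseqs I"
    and coord: "\<And>k x. k \<in> I \<Longrightarrow> x \<in> bitseqs I \<Longrightarrow> F x k = x k + a k"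
  shows "F \<in> measurable \<mu> \<mu>"
proof (rule measurable_sigma_sets[OF sets_mu])
  show "(\<lambda>k. {x \<in> bitseqs I. x k = 1}) ` I \<subseteq> Pow (bitseqs I)" by auto
  show "F \<in> space \<mu> \<rightarrow> bitseqs I" using space by (simp add: space_mu)
  fix A assume "A \<in> (\<lambda>k. {x \<in> bitseqs I. x k = 1}) ` I"
  then obtain k where k: "k \<in> I" "A = {x \<in> bitseqs I. x k = 1}" by auto
  have "F -` A \<inter> space \<mu> = (if a k = 0 then {x \<in> bitseqs I. x k = 1}
      else space \<mu> - {x \<in> bitseqs I. x k = 1})"
    using space coord k by (auto simp: space_mu)
  then show "F -` A \<inter> space \<mu> \<in> sets \<mu>"
    using coordinate_set[OF k(1)] by auto
qed

lemma mirror_space: "x \<in> bitseqs I \<Longrightarrow> mirror x \<in> bitseqs I"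
  by (auto simp: bitseqs_def ones_def)

lemma mirror_mirror [simp]: "mirror (mirror x) = x"
  by (auto simp: fun_eq_iff)

lemma mirror_measurable: "mirror \<in> measurable \<mu> \<mu>"
  by (rule measurable_bitseqsI[where a="\<lambda>_. 1"]) (simp_all add: mirror_space, simp add: ones_def)

lemma delta_finite: "k \<in> I \<Longrightarrow> delta k \<in> finite_bitseqs I"
  by (auto simp: finite_bitseqs_def bitseqs_def delta_def)

lemma shift_space: "k \<in> I \<Longrightarrow> x \<in> bitseqs I \<Longrightarrow> x + delta k \<in> bitseqs I"
  by (auto simp: bitseqs_def delta_def)

lemma shift_shift [simp]: "x + delta k + delta k = x"
  by (auto simp: fun_eq_iff delta_def)

lemma mirror_shift: "mirror (x + delta k) = mirror x + delta k"
  by (auto simp: fun_eq_iff delta_def)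

lemma shift_measurable: "k \<in> I \<Longrightarrow> (\<lambda>x. x + delta k) \<in> measurable \<mu> \<mu>"
  by (rule measurable_bitseqsI[where a="delta k"]) (simp_all add: shift_space)

sublocale hilbert_field \<mu> \<H> \<nu>
proof -
  interpret sigma_finite_measure \<mu> using triple by (simp add: GW_triple_def)
  show "hilbert_field \<mu> \<H> \<nu>"
    by standard (use triple hdim in \<open>auto simp: GW_triple_def\<close>)
qed

lemma shift_nonsingular:
  assumes "k \<in> I"
  shows "nonsingular_involution \<mu> (\<lambda>x. x + delta k)"
proof
  show "(\<lambda>x. x + delta k) \<in> measurable \<mu> \<mu>" by (rule shift_measurable[OF assms])
  show "absolutely_continuous \<mu> (distr \<mu> \<mu> (\<lambda>x. x + delta k))"
    using triple delta_finite[OF assms]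
    by (auto simp: GW_triple_def equivalent_measures_def translate_def)
qed simp

lemma translate_deriv_eq:
  assumes "k \<in> I"
  shows "translate_deriv \<mu> (delta k) = nonsingular_involution.jac \<mu> (\<lambda>x. x + delta k)"
  by (rule ext)
     (simp add: translate_deriv_def translate_def nonsingular_involution.jac_def[OF shift_nonsingular[OF assms]])

lemma dim_shift: "k \<in> I \<Longrightarrow> AE x in \<mu>. \<nu> (x + delta k) = \<nu> x"
  using triple delta_finite by (simp add: GW_triple_def)

lemma c_unitary: "k \<in> I \<Longrightarrow> AE x in \<mu>. unitary_between (\<H> (\<nu> x)) (\<H> (\<nu> (x + delta k))) (c k x)"
  using triple by (simp add: GW_triple_def)

text \<open>The scalar factor of modulus one in the action of \<open>z\<^sub>k\<close>.\<close>

definition phase :: "nat \<Rightarrow> (nat \<Rightarrow> bit) \<Rightarrow> complex" where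
  "phase k x = (- 1) ^ ((\<Sum>j\<in>{1..<k}. of_bool (x j = 1)) + 1) * \<i>"

lemma phase_nonzero [simp]: "phase k x \<noteq> 0"
  by (simp add: phase_def)

lemma index_pos: "k \<in> I \<Longrightarrow> 1 \<le> k"
  using index by (auto simp: index_set_def)

lemma index_below: "k \<in> I \<Longrightarrow> {1..<k} \<subseteq> I"
  using index by (auto simp: index_set_def)

text \<open>The exponents of \<open>-1\<close> at \<open>x\<close> and \<open>mirror x\<close> add up to \<open>k + 1\<close>, and the conjugation of \<open>\<i>\<close>
  contributes one more sign.\<close>

lemma phase_mirror:
  assumes k: "k \<in> I" and x: "x \<in> bitseqs I"
  shows "cnj (phase k (mirror x)) = (- 1) ^ k * phase k x"
proof -
  define n :: "(nat \<Rightarrow> bit) \<Rightarrow> nat" where "n x = (\<Sum>j\<in>{1..<k}. of_bool (x j = 1))" for x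
  have "n (mirror x) + n x = (\<Sum>j\<in>{1..<k}. 1 :: nat)"
    unfolding n_def sum.distrib[symmetric]
    by (intro sum.cong) (use index_below[OF k] in \<open>auto simp: ones_def\<close>)
  then have "Suc (n (mirror x) + n x) = k" using index_pos[OF k] by simp
  then have "(- 1 :: complex) ^ k = (- 1) ^ Suc (n (mirror x) + n x)" by simp
  then have "(- 1 :: complex) ^ k * (- 1) ^ n x = - ((- 1) ^ n (mirror x))"
    by (simp add: power_add mult.assoc flip: power_mult_distrib)
  moreover have "phase k y = (- 1) ^ (n y + 1) * \<i>" for y
    by (simp only: phase_def n_def)
  ultimately show ?thesis by (simp flip: mult.assoc)
qed

lemma clifford: "clifford_module DI J"
  using action by (simp add: GW_action_def)

lemma J_carrier: "F \<in> carrier DI \<Longrightarrow> J w F \<in> carrier DI"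
  using clifford by (simp add: clifford_module_def)

text \<open>The Clifford action on fields instead of classes.\<close>

definition act :: "'z \<Rightarrow> ((nat \<Rightarrow> bit) \<Rightarrow> 'v) \<Rightarrow> (nat \<Rightarrow> bit) \<Rightarrow> 'v" where
  "act w f = rep (J w (cl f))"

lemma act_L2: "f \<in> L2 \<Longrightarrow> act w f \<in> L2"
  unfolding act_def by (intro rep_L2 J_carrier cl_carrier)

lemma cl_act: "f \<in> L2 \<Longrightarrow> cl (act w f) = J w (cl f)"
  unfolding act_def by (intro cl_rep J_carrier cl_carrier)

lemma act_cong: "AE x in \<mu>. f x = g x \<Longrightarrow> act w f = act w g"
  unfolding act_def using cl_cong by simp

lemma act_basis:
  assumes "k \<in> I" "f \<in> L2"
  shows "AE x in \<mu>. act (z k) f x =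
    (phase k x * complex_of_real (sqrt (translate_deriv \<mu> (delta k) x))) *\<^sub>C c k x (f (x + delta k))"
proof -
  have "act (z k) f \<in> J (z k) (cl f)"
    unfolding act_def by (intro rep_mem J_carrier cl_carrier assms)
  then show ?thesis
    using action assms cl_carrier[OF assms(2)] cl_mem[OF assms(2)]
    unfolding GW_action_def phase_def by blast
qed

text \<open>The function \<open>(-1)\<close> to the power \<open>x\<^sub>k\<close>.\<close>

definition parity :: "nat \<Rightarrow> (nat \<Rightarrow> bit) \<Rightarrow> complex" where
  "parity k x = (- 1) ^ of_bool (x k = 1)"

lemma act_basis_i:
  assumes "k \<in> I" "f \<in> L2"
  shows "AE x in \<mu>. act (\<sigma> (z k)) f x = (parity k x * \<i>) *\<^sub>C act (z k) f x"
proof -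
  have "act (z k) f \<in> J (z k) (cl f)" "act (\<sigma> (z k)) f \<in> J (\<sigma> (z k)) (cl f)"
    unfolding act_def by (intro rep_mem J_carrier cl_carrier assms)+
  then show ?thesis
    using action assms cl_carrier[OF assms(2)]
    unfolding GW_action_def parity_def by blast
qed

lemma act_linear:
  assumes f: "f \<in> L2"
  shows "AE x in \<mu>. act (a *\<^sub>R v + b *\<^sub>R w) f x = a *\<^sub>R act v f x + b *\<^sub>R act w f x"
proof -
  have "J (a *\<^sub>R v + b *\<^sub>R w) (cl f) =
      hadd DI (hscale DI (complex_of_real a) (J v (cl f))) (hscale DI (complex_of_real b) (J w (cl f)))"
    using clifford cl_carrier[OF f] unfolding clifford_module_def by blast
  also have "\<dots> = cl (\<lambda>x. complex_of_real a *\<^sub>C act v f x + complex_of_real b *\<^sub>C act w f x)"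
    unfolding cl_act[OF f, symmetric] by (intro combination_cl act_L2 f)
  finally show ?thesis
    using rep_cl[OF L2_combination[OF act_L2[OF f] act_L2[OF f], of "complex_of_real a" v "complex_of_real b" w]]
    by (simp add: act_def[of "a *\<^sub>R v + b *\<^sub>R w"] scaleC_of_real)
qed

lemma act_square:
  assumes f: "f \<in> L2"
  shows "AE x in \<mu>. act w (act w f) x = - (inner w w *\<^sub>R f x)"
proof -
  have "hadd DI (J w (J w (cl f))) (J w (J w (cl f))) = hscale DI (complex_of_real (- 2 * inner w w)) (cl f)"
    using clifford cl_carrier[OF f] unfolding clifford_module_def by blast
  then have "cl (\<lambda>x. act w (act w f) x + act w (act w f) x) = cl (\<lambda>x. complex_of_real (- 2 * inner w w) *\<^sub>C f x)"
    using f by (simp only: cl_act[symmetric] act_L2 hadd_cl hscale_cl)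
  then have "AE x in \<mu>. act w (act w f) x + act w (act w f) x = (- 2 * inner w w) *\<^sub>R f x"
    unfolding scaleC_of_real by (rule cl_eq_iff[THEN iffD1, rotated]) (intro L2_add act_L2 f)
  then show ?thesis
  proof eventually_elim
    case (elim x)
    then have "2 *\<^sub>R act w (act w f) x = 2 *\<^sub>R (- (inner w w *\<^sub>R f x))"
      by (simp add: scaleR_2 flip: scaleR_scaleR)
    then show ?case by (simp only: scaleR_cancel_left) simp
  qed
qed

lemma act_bounded:
  obtains C where "\<And>w f. f \<in> L2 \<Longrightarrow>
    (LINT x|\<mu>. (norm (act w f x))\<^sup>2) \<le> C * (norm w)\<^sup>2 * (LINT x|\<mu>. (norm (f x))\<^sup>2)"
proof -
  have "\<exists>C. \<forall>w. \<forall>F\<in>carrier DI. hnorm DI (J w F) \<le> C * norm w * hnorm DI F"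
    using clifford unfolding clifford_module_def by (elim conjE)
  then obtain C where C: "\<And>w F. F \<in> carrier DI \<Longrightarrow> hnorm DI (J w F) \<le> C * norm w * hnorm DI F"
    by blast
  have "(LINT x|\<mu>. (norm (act w f x))\<^sup>2) \<le> C\<^sup>2 * (norm w)\<^sup>2 * (LINT x|\<mu>. (norm (f x))\<^sup>2)"
    if f: "f \<in> L2" for w f
  proof -
    have nn: "(LINT x|\<mu>. (norm (g x))\<^sup>2) \<ge> 0" for g :: "(nat \<Rightarrow> bit) \<Rightarrow> 'v"
      by (rule Bochner_Integration.integral_nonneg) simp
    have "sqrt (LINT x|\<mu>. (norm (act w f x))\<^sup>2) \<le> C * norm w * sqrt (LINT x|\<mu>. (norm (f x))\<^sup>2)"
      using C[OF cl_carrier[OF f], of w] by (simp add: hnorm_cl act_L2 f flip: cl_act)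
    then have "(sqrt (LINT x|\<mu>. (norm (act w f x))\<^sup>2))\<^sup>2
        \<le> (C * norm w * sqrt (LINT x|\<mu>. (norm (f x))\<^sup>2))\<^sup>2"
      by (rule power_mono) (simp add: nn)
    then show ?thesis by (simp add: power_mult_distrib nn)
  qed
  then show ?thesis by (rule that)
qed

end

context GW_module
begin

text \<open>Commutation of a real structure with the action of all vectors only has to be checked on the
  orthonormal basis, whose span is dense: the commutator \<open>dev w\<close> is linear in \<open>w\<close> and bounded by a
  multiple of \<open>\<parallel>w\<parallel>\<close> in norm.\<close>

lemma commute_extend:
  assumes s: "field_real_structure \<mu> \<H> \<nu> s"
    and gen: "\<And>w f. w \<in> z ` I \<union> (\<lambda>k. \<sigma> (z k)) ` I \<Longrightarrow> f \<in> L2 \<Longrightarrow>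
      AE x in \<mu>. s (act w f) x = act w (s f) x"
    and f: "f \<in> L2"
  shows "AE x in \<mu>. s (act w f) x = act w (s f) x"
proof -
  interpret field_real_structure \<mu> \<H> \<nu> s by (rule s)
  define dev where "dev w x = s (act w f) x - act w (s f) x" for w x
  have dev: "dev w \<in> L2" for w
    unfolding dev_def by (intro L2_diff s_L2 act_L2 f)
  have lin: "AE x in \<mu>. dev (a *\<^sub>R v + b *\<^sub>R w) x = a *\<^sub>R dev v x + b *\<^sub>R dev w x" for a b v w
  proof -
    have "AE x in \<mu>. s (act (a *\<^sub>R v + b *\<^sub>R w) f) x =
        s (\<lambda>x. complex_of_real a *\<^sub>C act v f x + complex_of_real b *\<^sub>C act w f x) x"
      using act_linear[OF f, of a v b w]
      by (intro s_cong L2_combination act_L2 f) (simp add: scaleC_of_real)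
    then show ?thesis
      using s_antilinear[OF act_L2[OF f] act_L2[OF f], of "complex_of_real a" v "complex_of_real b" w]
        act_linear[OF s_L2[OF f], of a v b w]
      by eventually_elim (simp add: dev_def scaleC_of_real algebra_simps)
  qed
  obtain C where C: "\<And>w f. f \<in> L2 \<Longrightarrow>
      (LINT x|\<mu>. (norm (act w f x))\<^sup>2) \<le> C * (norm w)\<^sup>2 * (LINT x|\<mu>. (norm (f x))\<^sup>2)"
    using act_bounded by blast
  define K where "K = 4 * C * (LINT x|\<mu>. (norm (f x))\<^sup>2)"
  have bound: "(LINT x|\<mu>. (norm (dev w x))\<^sup>2) \<le> K * (norm w)\<^sup>2" for w
  proof -
    let ?u = "s (act w f)" and ?v = "act w (s f)"
    have u: "?u \<in> L2" and v: "?v \<in> L2" by (intro s_L2 act_L2 f)+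
    have "(LINT x|\<mu>. (norm (dev w x))\<^sup>2) \<le> (LINT x|\<mu>. 2 * (norm (?u x))\<^sup>2 + 2 * (norm (?v x))\<^sup>2)"
    proof (rule integral_mono)
      show "(norm (dev w x))\<^sup>2 \<le> 2 * (norm (?u x))\<^sup>2 + 2 * (norm (?v x))\<^sup>2" for x
        using norm_add_square_le[of "?u x" "- ?v x"] by (simp add: dev_def)
    qed (use L2_integrable[OF u] L2_integrable[OF v] L2_integrable[OF dev] in auto)
    also have "\<dots> = 2 * (LINT x|\<mu>. (norm (act w f x))\<^sup>2) + 2 * (LINT x|\<mu>. (norm (act w (s f) x))\<^sup>2)"
      using L2_integrable[OF u] L2_integrable[OF v] s_norm[OF act_L2[OF f]] by simp
    also have "\<dots> \<le> K * (norm w)\<^sup>2"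
      using C[OF f, of w] C[OF s_L2[OF f], of w] by (simp add: K_def s_norm[OF f] algebra_simps)
    finally show ?thesis .
  qed
  have span: "AE x in \<mu>. dev w x = 0" if "w \<in> span (z ` I \<union> (\<lambda>k. \<sigma> (z k)) ` I)" for w
    using that
  proof (induction rule: span_induct_alt)
    case base
    show ?case using lin[of 0 0 0 0] by simp
  next
    case (step a v w)
    have "AE x in \<mu>. dev v x = 0" using gen[OF step(1) f] by (simp add: dev_def)
    then show ?case using step(2) lin[of a v 1 w] by (auto elim: AE_mp)
  qed
  have "w \<in> closure (span (z ` I \<union> (\<lambda>k. \<sigma> (z k)) ` I))"
    using ubasis by (simp add: unitary_basis_def)
  then obtain y where y: "\<And>n. y n \<in> span (z ` I \<union> (\<lambda>k. \<sigma> (z k)) ` I)" "y \<longlonglongrightarrow> w"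
    by (auto simp: closure_sequential)
  have "(LINT x|\<mu>. (norm (dev w x))\<^sup>2) \<le> K * (norm (w - y n))\<^sup>2" for n
  proof -
    have "AE x in \<mu>. dev w x = dev (w - y n) x"
      using lin[of 1 "w - y n" 1 "y n"] span[OF y(1)[of n]] by eventually_elim simp
    from integral_norm_square_cong[OF dev dev this] bound[of "w - y n"] show ?thesis by simp
  qed
  moreover have "(\<lambda>n. K * (norm (w - y n))\<^sup>2) \<longlonglongrightarrow> K * (norm (w - w))\<^sup>2"
    by (intro tendsto_intros y(2))
  ultimately have "(LINT x|\<mu>. (norm (dev w x))\<^sup>2) \<le> 0"
    by (intro LIMSEQ_le_const[of "\<lambda>n. K * (norm (w - y n))\<^sup>2"]) auto
  then have "AE x in \<mu>. dev w x = 0" by (rule L2_AE_zero[OF dev])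
  then show ?thesis by (simp add: dev_def)
qed

lemma parity_measurable: "k \<in> I \<Longrightarrow> parity k \<in> borel_measurable \<mu>"
proof -
  assume k: "k \<in> I"
  have "(\<lambda>x. if x \<in> {x \<in> bitseqs I. x k = 1} then - 1 else 1 :: complex) \<in> borel_measurable \<mu>"
    by (intro measurable_If_set sets.Int coordinate_set k) auto
  then show ?thesis
    by (rule measurable_cong[THEN iffD1, rotated]) (auto simp: parity_def space_mu)
qed

lemma L2_parity: "k \<in> I \<Longrightarrow> f \<in> L2 \<Longrightarrow> (\<lambda>x. parity k x *\<^sub>C f x) \<in> L2"
  by (rule L2_mult[where B=1]) (auto simp: parity_measurable, simp add: parity_def norm_power)

lemma basis_unit: "k \<in> I \<Longrightarrow> inner (z k) (z k) = 1"
  using ubasis by (simp add: unitary_basis_def)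

text \<open>The square of the action of \<open>z\<^sub>k\<close> is \<open>-1\<close>, so its product with the action of \<open>\<sigma> z\<^sub>k\<close> is a
  multiplication operator.\<close>

lemma act_act_basis:
  assumes k: "k \<in> I" and f: "f \<in> L2"
  shows "AE x in \<mu>. act (\<sigma> (z k)) (act (z k) f) x = (- \<i>) *\<^sub>C (parity k x *\<^sub>C f x)"
  using act_basis_i[OF k act_L2[OF f, of "z k"]] act_square[OF f, of "z k"]
proof eventually_elim
  case (elim x)
  then show ?case
    by (simp add: basis_unit[OF k] scaleC_scaleC scaleC_minus_left scaleC_minus_right mult.commute)
qed

text \<open>An invariant real structure commutes with the product of actions above and anticommutes with
  \<open>\<i>\<close>, so it anticommutes with multiplication by \<open>parity k\<close>.\<close>

lemma real_structure_parity:
  assumes s: "field_real_structure \<mu> \<H> \<nu> s"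
    and comm: "\<And>w f. f \<in> L2 \<Longrightarrow> AE x in \<mu>. s (act w f) x = act w (s f) x"
    and k: "k \<in> I" and f: "f \<in> L2"
  shows "AE x in \<mu>. s (\<lambda>x. parity k x *\<^sub>C f x) x = - (parity k x *\<^sub>C s f x)"
proof -
  interpret field_real_structure \<mu> \<H> \<nu> s by (rule s)
  let ?g = "act (\<sigma> (z k)) (act (z k) f)"
  have pf: "(\<lambda>x. parity k x *\<^sub>C f x) \<in> L2" by (rule L2_parity[OF k f])
  have "AE x in \<mu>. parity k x *\<^sub>C f x = \<i> *\<^sub>C ?g x + 0 *\<^sub>C ?g x"
    using act_act_basis[OF k f] by eventually_elim (simp add: scaleC_scaleC)
  then have "AE x in \<mu>. s (\<lambda>x. parity k x *\<^sub>C f x) x = s (\<lambda>x. \<i> *\<^sub>C ?g x + 0 *\<^sub>C ?g x) x"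
    by (intro s_cong pf L2_combination act_L2 f)
  moreover have "AE x in \<mu>. s (\<lambda>x. \<i> *\<^sub>C ?g x + 0 *\<^sub>C ?g x) x = cnj \<i> *\<^sub>C s ?g x + cnj 0 *\<^sub>C s ?g x"
    by (intro s_antilinear act_L2 f)
  moreover
  have "AE x in \<mu>. s ?g x = act (\<sigma> (z k)) (s (act (z k) f)) x"
    by (intro comm act_L2 f)
  then have "AE x in \<mu>. s ?g x = act (\<sigma> (z k)) (act (z k) (s f)) x"
    by (simp only: act_cong[OF comm[OF f]])
  moreover note act_act_basis[OF k s_L2[OF f]]
  ultimately show ?thesis
    by eventually_elim (simp add: scaleC_scaleC flip: scaleC_minus_left)
qed

lemma real_structure_coordinate:
  assumes s: "field_real_structure \<mu> \<H> \<nu> s"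
    and comm: "\<And>w f. f \<in> L2 \<Longrightarrow> AE x in \<mu>. s (act w f) x = act w (s f) x"
    and k: "k \<in> I" and f: "f \<in> L2" and E: "E = {x \<in> bitseqs I. x k = 1}"
  shows "AE x in \<mu>. s (\<lambda>x. indicator E x *\<^sub>C f x) x = indicator E (mirror x) *\<^sub>C s f x"
proof -
  interpret field_real_structure \<mu> \<H> \<nu> s by (rule s)
  have pf: "(\<lambda>x. parity k x *\<^sub>C f x) \<in> L2" by (rule L2_parity[OF k f])
  have "E \<in> sets \<mu>" using coordinate_set[OF k] by (simp add: E)
  then have ind: "(\<lambda>x. indicator E x *\<^sub>C f x) \<in> L2"
    by (intro L2_mult[where B=1] f) (auto simp: indicator_def)
  have half: "(1 / 2) *\<^sub>C v + (1 / 2) *\<^sub>C v = v" for v :: 'v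
    by (simp flip: scaleC_add_left)
  \<comment> \<open>The indicator of \<open>E\<close> is \<open>(1 - parity k) / 2\<close>.\<close>
  have "AE x in \<mu>. s (\<lambda>x. indicator E x *\<^sub>C f x) x =
      s (\<lambda>x. (1 / 2) *\<^sub>C f x + (- (1 / 2)) *\<^sub>C (parity k x *\<^sub>C f x)) x"
  proof (intro s_cong ind L2_combination f pf AE_I2)
    fix x assume "x \<in> space \<mu>"
    then show "indicator E x *\<^sub>C f x = (1 / 2) *\<^sub>C f x + (- (1 / 2)) *\<^sub>C (parity k x *\<^sub>C f x)"
      by (auto simp: E space_mu parity_def scaleC_minus_left scaleC_minus_right scaleC_minus_one half)
  qed
  moreover have "AE x in \<mu>. s (\<lambda>x. (1 / 2) *\<^sub>C f x + (- (1 / 2)) *\<^sub>C (parity k x *\<^sub>C f x)) x =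
      cnj (1 / 2) *\<^sub>C s f x + cnj (- (1 / 2)) *\<^sub>C s (\<lambda>x. parity k x *\<^sub>C f x) x"
    by (intro s_antilinear f pf)
  moreover have "AE x in \<mu>. s (\<lambda>x. parity k x *\<^sub>C f x) x = - (parity k x *\<^sub>C s f x)"
    by (rule real_structure_parity[OF s comm k f])
  moreover note AE_space
  ultimately show ?thesis
  proof eventually_elim
    case (elim x)
    then show ?case
      using k mirror_space[of x]
      by (auto simp: E space_mu parity_def scaleC_minus_left scaleC_minus_right scaleC_minus_one
          ones_def half)
  qed
qed

end

text \<open>A module together with fibre operators over the reflection.\<close>

locale GW_fibrewise = GW_module +
  fixes r
  assumes fibrewise: "fibrewise_real_structure \<mu> \<H> \<nu> (\<lambda>x. ones I - x) r"
begin

sublocale fibrewise_real_structure \<mu> \<H> \<nu> "\<lambda>x. ones I - x" r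
  by (rule fibrewise)

text \<open>Here \<open>h\<close> is the image of \<open>f\<close> under the real structure defined by \<open>r\<close>. The left-hand equation is
  commutation with the action of \<open>z\<^sub>k\<close> at \<open>f\<close> and \<open>x\<close>; it is equivalent to the relation between
  \<open>r\<close> and \<open>c\<^sub>k\<close> on a single vector, since up to the sign \<open>(-1)\<^sup>k\<close> both sides carry the
  same nonzero scalar.\<close>

lemma commute_basis_iff:
  assumes k: "k \<in> I" and f: "f \<in> L2" and h: "h \<in> L2"
    and hf: "AE x in \<mu>. h x = sqrt (jac x) *\<^sub>R r x (f (mirror x))"
  shows "AE x in \<mu>. sqrt (jac x) *\<^sub>R r x (act (z k) f (mirror x)) = act (z k) h x \<longleftrightarrow>
    r x (c k (mirror x) (f (mirror x + delta k))) = (- 1) ^ k *\<^sub>R c k x (r (x + delta k) (f (mirror x + delta k)))"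
proof -
  interpret S: nonsingular_involution \<mu> "\<lambda>x. x + delta k" by (rule shift_nonsingular[OF k])
  have cocycle: "AE x in \<mu>. jac x * S.jac (mirror x) = S.jac x * jac (x + delta k)"
    by (rule jac_cocycle) (unfold_locales, simp add: mirror_shift)
  note act_f = AE_T[OF act_basis[OF k f]]
  note act_h = act_basis[OF k h]
  show ?thesis
    using act_f act_h S.AE_T[OF hf] cocycle jac_pos S.AE_T[OF jac_pos] S.jac_pos AE_T[OF S.jac_pos]
      r_T S.AE_T[OF r_T] c_unitary[OF k] AE_T[OF c_unitary[OF k]] dim_shift[OF k] AE_T[OF dim_shift[OF k]]
      AE_space
  proof eventually_elim
    case (elim x)
    define w where "w = f (mirror x + delta k)"
    define a where "a = sqrt (jac x) * sqrt (S.jac (mirror x))"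
    have x: "x \<in> bitseqs I" using elim by (simp add: space_mu)
    have a: "a > 0" using elim by (simp add: a_def)
    have a': "a = sqrt (S.jac x) * sqrt (jac (x + delta k))"
      using elim by (simp add: a_def flip: real_sqrt_mult)
    have dims: "\<nu> (mirror x) = \<nu> x" "\<nu> (x + delta k) = \<nu> x" "\<nu> (mirror x + delta k) = \<nu> x"
      using elim by auto
    have w: "w \<in> \<H> (\<nu> x)"
      using L2_fibre[OF f, of "mirror x + delta k"] x k dims
      by (simp add: w_def space_mu shift_space mirror_space)
    have r: "antilinear_isometry_between (\<H> (\<nu> x)) (\<H> (\<nu> x)) (r x)"
      "antilinear_isometry_between (\<H> (\<nu> x)) (\<H> (\<nu> x)) (r (x + delta k))"
      using elim dims by auto
    have u: "unitary_between (\<H> (\<nu> x)) (\<H> (\<nu> x)) (c k x)"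
      "unitary_between (\<H> (\<nu> x)) (\<H> (\<nu> x)) (c k (mirror x))"
      using elim dims by auto
    let ?L = "r x (c k (mirror x) w)" and ?R = "c k x (r (x + delta k) w)"
    have "sqrt (jac x) *\<^sub>R r x (act (z k) f (mirror x)) =
        sqrt (jac x) *\<^sub>R r x ((phase k (mirror x) * complex_of_real (sqrt (S.jac (mirror x)))) *\<^sub>C c k (mirror x) w)"
      using elim by (simp add: translate_deriv_eq[OF k] w_def)
    also have "\<dots> = sqrt (jac x) *\<^sub>R ((cnj (phase k (mirror x)) * complex_of_real (sqrt (S.jac (mirror x)))) *\<^sub>C ?L)"
      by (simp add: antilinear_isometry_scaleC[OF r(1)] unitary_mem[OF u(2) w])
    also have "\<dots> = a *\<^sub>R (phase k x *\<^sub>C ((- 1) ^ k *\<^sub>R ?L))"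
      by (simp add: phase_mirror[OF k x] a_def scaleC_scaleC flip: scaleC_of_real) (simp add: mult_ac)
    finally have L: "sqrt (jac x) *\<^sub>R r x (act (z k) f (mirror x)) = a *\<^sub>R (phase k x *\<^sub>C ((- 1) ^ k *\<^sub>R ?L))" .
    have "act (z k) h x = (phase k x * complex_of_real (sqrt (S.jac x))) *\<^sub>C
        c k x (sqrt (jac (x + delta k)) *\<^sub>R r (x + delta k) w)"
      using elim by (simp add: translate_deriv_eq[OF k] w_def mirror_shift)
    also have "\<dots> = (phase k x * complex_of_real (sqrt (S.jac x))) *\<^sub>C (sqrt (jac (x + delta k)) *\<^sub>R ?R)"
      by (simp add: unitary_scaleR[OF u(1)] antilinear_isometry_mem[OF r(2) w])
    also have "\<dots> = a *\<^sub>R (phase k x *\<^sub>C ?R)"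
      by (simp add: a' scaleC_scaleC flip: scaleC_of_real) (simp add: mult_ac)
    finally have R: "act (z k) h x = a *\<^sub>R (phase k x *\<^sub>C ?R)" .
    have cancel: "phase k x *\<^sub>C v = phase k x *\<^sub>C v' \<longleftrightarrow> v = v'" for v v' :: 'b
    proof
      assume "phase k x *\<^sub>C v = phase k x *\<^sub>C v'"
      then have "inverse (phase k x) *\<^sub>C phase k x *\<^sub>C v = inverse (phase k x) *\<^sub>C phase k x *\<^sub>C v'" by simp
      then show "v = v'" by (simp add: scaleC_scaleC)
    qed simp
    have "sqrt (jac x) *\<^sub>R r x (act (z k) f (mirror x)) = act (z k) h x \<longleftrightarrow> (- 1) ^ k *\<^sub>R ?L = ?R"
      unfolding L R using a by (simp add: cancel)
    also have "\<dots> \<longleftrightarrow> ?L = (- 1) ^ k *\<^sub>R ?R"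
      by (cases "even k") (auto simp: eq_neg_iff_add_eq_0 neg_eq_iff_add_eq_0)
    finally show ?case by (simp add: w_def)
  qed
qed

end

context GW_module
begin

text \<open>The decomposition of an invariant real structure into fibre operators. The relation with \<open>c\<^sub>k\<close>
  is obtained on the basis fields and extended by antilinearity and isometry.\<close>

lemma fibre_ops_of_real_structure:
  assumes S: "invariant_real_structure DI J S"
  shows "equivalent_measures \<mu> (reflect I \<mu>)"
    and "AE x in \<mu>. \<nu> x = \<nu> (mirror x)"
    and "\<exists>r. measurable_operator_field \<H> \<mu> \<nu> r \<and>
       (AE x in \<mu>. antilinear_isometry_between (\<H> (\<nu> x)) (\<H> (\<nu> (mirror x))) (r x)) \<and>
       (AE x in \<mu>. \<forall>v \<in> \<H> (\<nu> x). r x (r (mirror x) v) = v) \<and>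
       (\<forall>k\<in>I. AE x in \<mu>. \<forall>v \<in> \<H> (\<nu> x).
          r x (c k (mirror x) v) = (- 1) ^ k *\<^sub>R c k x (r (x + delta k) v))"
proof -
  define s where "s f = rep (S (cl f))" for f
  have real: "field_real_structure \<mu> \<H> \<nu> s"
    unfolding s_def by (rule field_real_structureI[OF S])
  interpret field_real_structure \<mu> \<H> \<nu> s by (rule real)
  have comm: "AE x in \<mu>. s (act w f) x = act w (s f) x" if f: "f \<in> L2" for w f
  proof -
    have SF: "S (cl f) \<in> carrier DI"
      using S cl_carrier[OF f] by (simp add: invariant_real_structure_def)
    have "S (J w (cl f)) = J w (S (cl f))"
      using S cl_carrier[OF f] by (simp add: invariant_real_structure_def)
    then have "s (act w f) = act w (s f)"
      by (simp add: s_def cl_act[OF f] act_def cl_rep[OF SF] cl_rep[OF J_carrier[OF cl_carrier[OF f]]])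
    then show ?thesis by simp
  qed
  interpret implementing_real_structure \<mu> \<H> \<nu> s mirror "(\<lambda>k. {x \<in> bitseqs I. x k = 1}) ` I"
  proof
    show "mirror \<in> measurable \<mu> \<mu>" by (rule mirror_measurable)
    show "sets \<mu> = sigma_sets (space \<mu>) ((\<lambda>k. {x \<in> bitseqs I. x k = 1}) ` I)"
      by (simp add: sets_mu space_mu)
    fix E f assume "E \<in> (\<lambda>k. {x \<in> bitseqs I. x k = 1}) ` I" and f: "f \<in> L2"
    then obtain k where "k \<in> I" "E = {x \<in> bitseqs I. x k = 1}" by auto
    then show "AE x in \<mu>. s (\<lambda>x. indicator E x *\<^sub>C f x) x = indicator E (mirror x) *\<^sub>C s f x"
      using real_structure_coordinate[OF real comm _ f] by blast
  qed simp
  show "equivalent_measures \<mu> (reflect I \<mu>)"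
    using absolutely_continuous_T absolutely_continuous_distr_T
    by (simp add: equivalent_measures_def reflect_def)
  show dim: "AE x in \<mu>. \<nu> x = \<nu> (mirror x)" by (rule dim_T)
  interpret R: GW_fibrewise I \<sigma> z \<H> \<mu> \<nu> c J fibre_op
  proof (intro GW_fibrewise.intro GW_fibrewise_axioms.intro)
    show "GW_module I \<sigma> z \<H> \<mu> \<nu> c J" ..
    show "fibrewise_real_structure \<mu> \<H> \<nu> (\<lambda>x. mirror x) fibre_op"
      by standard (fact dim fibre_op_measurable fibre_op_antilinear_isometry fibre_op_involution)+
  qed
  have rel: "AE x in \<mu>. \<forall>v \<in> \<H> (\<nu> x).
      fibre_op x (c k (mirror x) v) = (- 1) ^ k *\<^sub>R c k x (fibre_op (x + delta k) v)"
    if k: "k \<in> I" for k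
  proof -
    interpret S: nonsingular_involution \<mu> "\<lambda>x. x + delta k" by (rule shift_nonsingular[OF k])
    have "AE x in \<mu>. \<forall>j. fibre_op x (c k (mirror x) (basis_field j (mirror x + delta k))) =
        (- 1) ^ k *\<^sub>R c k x (fibre_op (x + delta k) (basis_field j (mirror x + delta k)))"
      unfolding AE_all_countable
    proof
      fix j
      note b = basis_field_L2[of j]
      show "AE x in \<mu>. fibre_op x (c k (mirror x) (basis_field j (mirror x + delta k))) =
          (- 1) ^ k *\<^sub>R c k x (fibre_op (x + delta k) (basis_field j (mirror x + delta k)))"
        using R.commute_basis_iff[OF k b s_L2[OF b] s_eq_fibre_op[OF b]] comm[OF b, of "z k"]
          s_eq_fibre_op[OF act_L2[OF b, of "z k"]]
        by eventually_elim (metis (no_types, lifting))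
    qed
    then show ?thesis
      using R.r_T S.AE_T[OF R.r_T] c_unitary[OF k] AE_T[OF c_unitary[OF k]] dim_shift[OF k]
        AE_T[OF dim_shift[OF k]] AE_space
    proof eventually_elim
      case (elim x)
      have x: "x \<in> bitseqs I" using elim by (simp add: space_mu)
      have dims: "\<nu> (mirror x) = \<nu> x" "\<nu> (x + delta k) = \<nu> x" "\<nu> (mirror x + delta k) = \<nu> x"
        using elim by auto
      have r: "antilinear_isometry_between (\<H> (\<nu> x)) (\<H> (\<nu> x)) (fibre_op x)"
        "antilinear_isometry_between (\<H> (\<nu> x)) (\<H> (\<nu> x)) (fibre_op (x + delta k))"
        using elim dims by auto
      have u: "unitary_between (\<H> (\<nu> x)) (\<H> (\<nu> x)) (c k x)"
        "unitary_between (\<H> (\<nu> x)) (\<H> (\<nu> x)) (c k (mirror x))"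
        using elim dims by auto
      let ?L = "\<lambda>v. fibre_op x (c k (mirror x) v)"
      let ?R = "\<lambda>v. (- 1) ^ k *\<^sub>R c k x (fibre_op (x + delta k) v)"
      have H: "\<H> (\<nu> x) = closure (cspan (range (basis (\<nu> x))))"
        using fibre_eq_span dim_pos elim by simp
      note um = unitary_mem[OF u(2)] and rm = antilinear_isometry_mem[OF r(2)]
      have eq: "?L b = ?R b" if "b \<in> range (basis (\<nu> x))" for b
      proof -
        from that obtain j where j: "b = basis (\<nu> x) j" by auto
        have b: "b \<in> \<H> (\<nu> x)" using basis_mem dim_pos elim j by simp
        let ?w = "weight (mirror x + delta k)"
        have w: "?w > 0" using x k by (intro weight_pos) (simp add: space_mu shift_space mirror_space)
        have "basis_field j (mirror x + delta k) = ?w *\<^sub>R b"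
          using dims by (simp add: basis_field_def j)
        then have "?w *\<^sub>R ?L b = ?w *\<^sub>R ?R b"
          using elim(1)[rule_format, of j]
          by (simp add: unitary_scaleR[OF u(2) b] antilinear_isometry_scaleR[OF r(2) b]
              antilinear_isometry_scaleR[OF r(1) um[OF b]] unitary_scaleR[OF u(1) rm[OF b]]
              scaleR_left_commute[of ?w])
        then show ?thesis by (rule scaleR_left_imp_eq[rotated]) (use w in simp)
      qed
      show ?case
      proof
        fix v assume v: "v \<in> \<H> (\<nu> x)"
        show "?L v = ?R v"
        proof (rule semilinear_isometry_eqI[where \<phi>=cnj and B="range (basis (\<nu> x))" and
              T="?L" and T'="?R", folded H])
          show "?L (a *\<^sub>C v + b *\<^sub>C w) = cnj a *\<^sub>C ?L v + cnj b *\<^sub>C ?L w"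
            if "v \<in> \<H> (\<nu> x)" "w \<in> \<H> (\<nu> x)" for a b v w
            using that by (simp add: unitary_combination[OF u(2)] antilinear_isometry_combination[OF r(1)] um)
          show "?R (a *\<^sub>C v + b *\<^sub>C w) = cnj a *\<^sub>C ?R v + cnj b *\<^sub>C ?R w"
            if "v \<in> \<H> (\<nu> x)" "w \<in> \<H> (\<nu> x)" for a b v w
            using that
            by (simp add: unitary_combination[OF u(1)] antilinear_isometry_combination[OF r(2)] rm
                scaleR_add_right scaleC_scaleR)
          show "norm (?L v) = norm v" if "v \<in> \<H> (\<nu> x)" for v
            using that by (simp add: unitary_norm[OF u(2)] antilinear_isometry_norm[OF r(1)] um)
          show "norm (?R v) = norm v" if "v \<in> \<H> (\<nu> x)" for v
            using that by (simp add: unitary_norm[OF u(1)] antilinear_isometry_norm[OF r(2)] rm)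
        qed (use eq v in auto)
      qed
    qed
  qed
  show "\<exists>r. measurable_operator_field \<H> \<mu> \<nu> r \<and>
       (AE x in \<mu>. antilinear_isometry_between (\<H> (\<nu> x)) (\<H> (\<nu> (mirror x))) (r x)) \<and>
       (AE x in \<mu>. \<forall>v \<in> \<H> (\<nu> x). r x (r (mirror x) v) = v) \<and>
       (\<forall>k\<in>I. AE x in \<mu>. \<forall>v \<in> \<H> (\<nu> x).
          r x (c k (mirror x) v) = (- 1) ^ k *\<^sub>R c k x (r (x + delta k) v))"
    using fibre_op_measurable fibre_op_antilinear_isometry fibre_op_involution rel by blast
qed

text \<open>The real structure defined by fibre operators is invariant. The action of \<open>\<sigma> z\<^sub>k\<close> is handled by
  that of \<open>z\<^sub>k\<close>: the signs from reflecting \<open>x\<^sub>k\<close> and from conjugating \<open>\<i>\<close> cancel.\<close>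

lemma real_structure_of_fibre_ops:
  assumes equiv: "equivalent_measures \<mu> (reflect I \<mu>)"
    and dim: "AE x in \<mu>. \<nu> x = \<nu> (mirror x)"
    and r: "measurable_operator_field \<H> \<mu> \<nu> r"
      "AE x in \<mu>. antilinear_isometry_between (\<H> (\<nu> x)) (\<H> (\<nu> (mirror x))) (r x)"
      "AE x in \<mu>. \<forall>v \<in> \<H> (\<nu> x). r x (r (mirror x) v) = v"
    and rel: "\<And>k. k \<in> I \<Longrightarrow> AE x in \<mu>. \<forall>v \<in> \<H> (\<nu> x).
          r x (c k (mirror x) v) = (- 1) ^ k *\<^sub>R c k x (r (x + delta k) v)"
  shows "\<exists>S. invariant_real_structure DI J S"
proof -
  have fibrewise: "fibrewise_real_structure \<mu> \<H> \<nu> mirror r"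
  proof (intro fibrewise_real_structure.intro fibrewise_real_structure_axioms.intro)
    show "hilbert_field \<mu> \<H> \<nu>" ..
    show "nonsingular_involution \<mu> mirror"
    proof
      show "absolutely_continuous \<mu> (distr \<mu> \<mu> mirror)"
        using equiv by (simp add: equivalent_measures_def reflect_def)
    qed (simp_all add: mirror_measurable)
  qed (fact dim r)+
  interpret GW_fibrewise I \<sigma> z \<H> \<mu> \<nu> c J r
    by (intro GW_fibrewise.intro GW_fibrewise_axioms.intro fibrewise) unfold_locales
  note real = field_real_structure_global_op
  interpret field_real_structure \<mu> \<H> \<nu> global_op by (rule real)
  have basis: "AE x in \<mu>. global_op (act (z k) f) x = act (z k) (global_op f) x"
    if k: "k \<in> I" and f: "f \<in> L2" for k f
    using commute_basis_iff[OF k f global_op_L2[OF f] global_op[OF f]] global_op[OF act_L2[OF f, of "z k"]]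
      rel[OF k] AE_T[OF dim_shift[OF k]] dim AE_space
  proof eventually_elim
    case (elim x)
    define w where "w = f (mirror x + delta k)"
    have "w \<in> \<H> (\<nu> (mirror x + delta k))"
      unfolding w_def
      by (rule L2_fibre[OF f]) (use elim k in \<open>simp add: space_mu shift_space mirror_space\<close>)
    then have "w \<in> \<H> (\<nu> x)" using elim by simp
    then show ?case using elim(1-3) unfolding w_def[symmetric] by simp
  qed
  have basis_i: "AE x in \<mu>. global_op (act (\<sigma> (z k)) f) x = act (\<sigma> (z k)) (global_op f) x"
    if k: "k \<in> I" and f: "f \<in> L2" for k f
    using global_op[OF act_L2[OF f, of "\<sigma> (z k)"]] global_op[OF act_L2[OF f, of "z k"]]
      AE_T[OF act_basis_i[OF k f]] act_basis_i[OF k global_op_L2[OF f]] basis[OF k f] r_T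
  proof eventually_elim
    case (elim x)
    have ri: "antilinear_isometry_between (\<H> (\<nu> x)) (\<H> (\<nu> x)) (r x)" using elim by simp
    have x: "mirror x \<in> space \<mu>" using elim by (simp add: space_mu mirror_space)
    have mem: "act (z k) f (mirror x) \<in> \<H> (\<nu> x)"
      using L2_fibre[OF act_L2[OF f] x] elim by simp
    have par: "cnj (parity k (mirror x) * \<i>) = parity k x * \<i>"
      using k by (cases "x k") (auto simp: parity_def ones_def)
    have "global_op (act (\<sigma> (z k)) f) x =
        sqrt (jac x) *\<^sub>R r x ((parity k (mirror x) * \<i>) *\<^sub>C act (z k) f (mirror x))"
      using elim by simp
    also have "\<dots> = (parity k x * \<i>) *\<^sub>C (sqrt (jac x) *\<^sub>R r x (act (z k) f (mirror x)))"
      by (simp only: antilinear_isometry_scaleC[OF ri mem] par scaleC_scaleR)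
    also have "\<dots> = act (\<sigma> (z k)) (global_op f) x"
      using elim by simp
    finally show ?case .
  qed
  have comm: "AE x in \<mu>. global_op (act w f) x = act w (global_op f) x" if "f \<in> L2" for w f
    by (rule commute_extend[OF real _ that]) (use basis basis_i in auto)
  have "invariant_real_structure DI J (\<lambda>F. cl (global_op (rep F)))"
  proof (rule invariant_real_structureI)
    fix w f assume f: "f \<in> L2"
    have "cl (global_op (rep (J w (cl f)))) = cl (act w (global_op f))"
      using cl_cong[OF comm[OF f, of w]] by (simp add: act_def)
    then show "cl (global_op (rep (J w (cl f)))) = J w (cl (global_op f))"
      by (simp add: cl_act global_op_L2 f)
  qed (rule J_carrier)
  then show ?thesis by blast
qed

end

theorem theorem3p5:
  fixes I :: "nat set"
    and \<sigma> :: "'z::{real_inner, complete_space, second_countable_topology} \<Rightarrow> 'z"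
    and z :: "nat \<Rightarrow> 'z"
    and \<H> :: "enat \<Rightarrow> 'v::{complex_hilbert, second_countable_topology} set"
    and \<mu> :: "(nat \<Rightarrow> bit) measure"
    and \<nu> :: "(nat \<Rightarrow> bit) \<Rightarrow> enat"
    and c :: "nat \<Rightarrow> (nat \<Rightarrow> bit) \<Rightarrow> 'v \<Rightarrow> 'v"
    and J :: "'z \<Rightarrow> ((nat \<Rightarrow> bit) \<Rightarrow> 'v) set \<Rightarrow> ((nat \<Rightarrow> bit) \<Rightarrow> 'v) set"
  assumes "index_set I"
    and "orthogonal_complex_structure \<sigma>"
    and "unitary_basis I \<sigma> z"
    and "\<And>n. 1 \<le> n \<Longrightarrow> has_hilbert_dim (\<H> n) n"
    and "GW_triple I \<H> \<mu> \<nu> c"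
    and "GW_action I \<sigma> z \<H> \<mu> \<nu> c J"
  shows "(\<exists>R. invariant_real_form (direct_integral \<H> \<mu> \<nu>) J R) \<longleftrightarrow>
    equivalent_measures \<mu> (reflect I \<mu>) \<and>
    (AE x in \<mu>. \<nu> x = \<nu> (ones I - x)) \<and>
    (\<exists>r :: (nat \<Rightarrow> bit) \<Rightarrow> 'v \<Rightarrow> 'v.
       measurable_operator_field \<H> \<mu> \<nu> r \<and>
       (AE x in \<mu>. antilinear_isometry_between (\<H> (\<nu> x)) (\<H> (\<nu> (ones I - x))) (r x)) \<and>
       (AE x in \<mu>. \<forall>v \<in> \<H> (\<nu> x). r x (r (ones I - x) v) = v) \<and>
       (\<forall>k\<in>I. AE x in \<mu>. \<forall>v \<in> \<H> (\<nu> x).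
          r x (c k (ones I - x) v) = (- 1) ^ k *\<^sub>R c k x (r (x + delta k) v)))"
    (is "?form \<longleftrightarrow> ?conditions")
proof -
  interpret GW_module I \<sigma> z \<H> \<mu> \<nu> c J
    by standard (fact assms)+
  have "?form \<longleftrightarrow> (\<exists>S. invariant_real_structure DI J S)"
    by (auto simp: invariant_real_form_def)
  also have "\<dots> \<longleftrightarrow> ?conditions"
    using fibre_ops_of_real_structure real_structure_of_fibre_ops by (intro iffI; elim exE conjE; blast)
  finally show ?thesis .
qed

end
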